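(* Let $d_1 \geq d_2 \geq \cdots \geq d_m \geq 2$ be integers that form the degree sequence of some tree. Among all trees whose degree sequence is $(d_1,\dots,d_m)$, the greedy tree with degree sequence $(d_1,\dots,d_m)$ has the maximum number of subtrees.
   Context: All trees are finite. A subtree of a tree $T$ is a nonempty connected subgraph of $T$; $f(T)$ denotes the number of subtrees of $T$. The degree sequence of a tree is the multiset of degrees of its non-leaf vertices, listed in non-increasing order (the number of leaves is then determined). The greedy tree with degree sequence $d_1 \geq d_2 \geq \cdots \geq d_m$ is the rooted tree built as follows: the root $r$ receives degree $d_1$ and gets $d_1$ children $r_1, r_2, \dots$, which receive the next largest available degrees with $d(r_1)\ge d(r_2)\ge\cdots$; then the children of $r_1$ are labelled $r_{11}, r_{12},\dots$ and receive the largest degrees still available with $d(r_{11})\ge d(r_{12})\ge \cdots$, then the same is done for the children of $r_2$, $r_3$, and so on; this is repeated level by level, always processing next the already-labelled vertex of largest degree whose children have not yet been assigned degrees (equivalently, the degrees $d_2,d_3,\dots$ are assigned in non-increasing order along the breadth-first order of the vertices, a non-root vertex of degree $d$ having $d-1$ children). Once all of $d_1,\dots,d_m$ are used, all remaining vertices are leaves. *)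

theory Defs
  imports "Graph_Theory.Digraph_Component"
begin

text \<open>
  Undirected simple graphs are the finite symmetric loop-free digraphs of the locale
  \<^locale>\<open>pair_graph\<close>; every edge is a pair of opposite arcs.  The predicate
  \<^const>\<open>tree\<close> of the library does not fit: on symmetric digraphs it counts the walk
  \<open>a, b, a\<close> along a single edge as a cycle.  Cycles of a simple graph are those of length
  at least 3.
\<close>

definition utree :: "'a pair_pre_digraph \<Rightarrow> bool" where
  "utree T \<longleftrightarrow> pair_graph T \<and> connected (with_proj T) \<and>
     \<not> (\<exists>p. pre_digraph.cycle (with_proj T) p \<and> length p \<ge> 3)"

text \<open>Nonemptiness is part of \<^const>\<open>connected\<close>.\<close>

definition subtrees :: "'a pair_pre_digraph \<Rightarrow> 'a pair_pre_digraph set" where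
  "subtrees T = {S. pair_graph S \<and> subgraph (with_proj S) (with_proj T) \<and>
     connected (with_proj S)}"

definition num_subtrees :: "'a pair_pre_digraph \<Rightarrow> nat" where
  "num_subtrees T = card (subtrees T)"

text \<open>
  Because arcs come in opposite pairs, the undirected degree of a vertex is its out-degree.
\<close>

definition degree_sequence :: "'a pair_pre_digraph \<Rightarrow> nat list" where
  "degree_sequence T = rev (sorted_list_of_multiset
     (image_mset (out_degree (with_proj T))
       (mset_set {v \<in> pverts T. out_degree (with_proj T) v \<noteq> 1})))"

text \<open>
  The vertices of the greedy tree are numbered \<open>0, 1, 2, \<dots>\<close> in breadth-first order, the root
  being \<open>0\<close>.  Vertex \<open>i\<close> receives the degree \<open>ds ! i\<close> as long as there is one and is a
  leaf otherwise.  The children of \<open>i\<close> are numbered consecutively, directly after the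
  children of \<open>0, \<dots>, i - 1\<close>.
\<close>

definition greedy_degree :: "nat list \<Rightarrow> nat \<Rightarrow> nat" where
  "greedy_degree ds i = (if i < length ds then ds ! i else 1)"

definition greedy_num_children :: "nat list \<Rightarrow> nat \<Rightarrow> nat" where
  "greedy_num_children ds i = (if i = 0 then greedy_degree ds i else greedy_degree ds i - 1)"

definition greedy_first_child :: "nat list \<Rightarrow> nat \<Rightarrow> nat" where
  "greedy_first_child ds i = 1 + (\<Sum>j<i. greedy_num_children ds j)"

definition greedy_children :: "nat list \<Rightarrow> nat \<Rightarrow> nat set" where
  "greedy_children ds i =
     {greedy_first_child ds i ..< greedy_first_child ds i + greedy_num_children ds i}"

definition greedy_tree :: "nat list \<Rightarrow> nat pair_pre_digraph" where
  "greedy_tree ds = (let E = {(i, j). j \<in> greedy_children ds i} in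
     \<lparr> pverts = insert 0 (Range E), parcs = E \<union> E\<inverse> \<rparr>)"

end

theory Submission
  imports Defs
begin

text \<open>
  Write \<open>f(v)\<close> for the number of subtrees containing \<open>v\<close>.  In a tree \<open>T\<close> that maximises the
  number of subtrees, shifting branches from \<open>v\<close> to \<open>u\<close> so that their degrees are swapped shows
  that \<open>d(u) < d(v)\<close> implies \<open>f(u) < f(v)\<close>.  For a path \<open>x, x', \<dots>, y', y\<close> replace the edges
  \<open>xx'\<close>, \<open>yy'\<close> by \<open>xy'\<close>, \<open>yx'\<close>: if \<open>X\<close>, \<open>M\<close>, \<open>Y\<close> are the three components left by removing the
  two edges, the number of subtrees grows by \<open>(f\<^sub>X(x) - f\<^sub>Y(y)) (f\<^sub>M(y') - f\<^sub>M(x'))\<close>.  As this is not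
  positive, \<open>f(x) < f(y)\<close> if and only if \<open>f(x') < f(y')\<close>.  Root \<open>T\<close> at a vertex where \<open>f\<close> is maximal.
  Moving along paths in lockstep, one finds that \<open>f\<close> does not increase from one level to the next and
  that vertices of one level with different parents are ordered like their parents.  So a
  breadth-first enumeration that lists siblings by decreasing \<open>f\<close> lists all vertices, and hence their
  degrees, in non-increasing order, and \<open>T\<close> is the greedy tree.
\<close>

section \<open>Connected vertex sets\<close>

definition conn :: "('a \<times> 'a) set \<Rightarrow> 'a set \<Rightarrow> bool" where
  "conn E S \<longleftrightarrow> (\<forall>u\<in>S. \<forall>v\<in>S. (u, v) \<in> (E \<inter> S \<times> S)\<^sup>*)"

text \<open>In a forest a subtree is determined by its vertex set, so subtrees are counted as
  connected vertex sets. \<open>W\<close> collects vertices that must be present: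
  \<open>W = {}\<close> gives all subtrees, \<open>W = {v}\<close> those counted by f(v). The empty
  set satisfies \<open>conn\<close>, hence the condition \<open>S \<noteq> {}\<close>.\<close>

definition csets :: "('a \<times> 'a) set \<Rightarrow> 'a set \<Rightarrow> 'a set \<Rightarrow> 'a set set" where
  "csets E V W = {S. S \<noteq> {} \<and> W \<subseteq> S \<and> S \<subseteq> V \<and> conn E S}"

definition count_conn :: "('a \<times> 'a) set \<Rightarrow> 'a set \<Rightarrow> 'a set \<Rightarrow> nat" where
  "count_conn E V W = card (csets E V W)"

definition star :: "'a \<Rightarrow> 'a set \<Rightarrow> ('a \<times> 'a) set" where
  "star a R = {a} \<times> R \<union> R \<times> {a}"

text \<open>The sets \<open>Q\<close> such that a new vertex joined to all of \<open>R\<close> makes \<open>Q\<close> connected.\<close>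

definition att :: "('a \<times> 'a) set \<Rightarrow> 'a set \<Rightarrow> 'a set \<Rightarrow> 'a set set" where
  "att E B R = {Q. Q \<noteq> {} \<and> Q \<subseteq> B \<and> (\<forall>q\<in>Q. \<exists>r\<in>R \<inter> Q. (r, q) \<in> (E \<inter> Q \<times> Q)\<^sup>*)}"

lemma rtrancl_map:
  assumes "(x, y) \<in> R\<^sup>*" and "\<And>a b. (a, b) \<in> R \<Longrightarrow> (h a, h b) \<in> S\<^sup>*"
  shows "(h x, h y) \<in> S\<^sup>*"
  using assms(1) by induction (auto intro: rtrancl_trans assms(2))

lemma sym_star: "sym (star a R)"
  by (auto simp: star_def sym_def)

lemma sym_restrict: "sym E \<Longrightarrow> sym (E \<inter> S \<times> S)"
  by (auto simp: sym_def)

lemma conn_from_center: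
  assumes "sym E" "\<And>u. u \<in> S \<Longrightarrow> (a, u) \<in> (E \<inter> S \<times> S)\<^sup>*"
  shows "conn E S"
proof -
  have "(u, a) \<in> (E \<inter> S \<times> S)\<^sup>*" if "u \<in> S" for u
    using assms(2)[OF that] sym_rtrancl[OF sym_restrict[OF assms(1)]] by (meson symD)
  then show ?thesis
    unfolding conn_def using assms(2) by (blast intro: rtrancl_trans)
qed

lemma finite_csets: "finite V \<Longrightarrow> finite (csets E V W)"
  by (rule finite_subset[of _ "Pow V"]) (auto simp: csets_def)

lemma att_singleton:
  assumes "sym E"
  shows "att E B {b} = csets E B {b}"
proof -
  have "Q \<in> csets E B {b}" if "Q \<in> att E B {b}" for Q
  proof -
    have *: "b \<in> Q \<and> (b, q) \<in> (E \<inter> Q \<times> Q)\<^sup>*" if "q \<in> Q" for q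
      using \<open>Q \<in> att E B {b}\<close> that by (auto simp: att_def)
    have "conn E Q"
      by (rule conn_from_center[OF assms, of Q b]) (use * in auto)
    then show ?thesis
      using that * by (auto simp: att_def csets_def)
  qed
  moreover have "Q \<in> att E B {b}" if "Q \<in> csets E B {b}" for Q
    using that by (auto simp: att_def csets_def conn_def)
  ultimately show ?thesis by blast
qed

text \<open>Neither side has to be connected. In \<open>opt_deg_less\<close> the side
  \<open>B\<close> is a union of branches and \<open>R\<close> the set of their top vertices; in
  \<open>opt_exchange\<close> the set \<open>R\<close> is a single vertex and the gluing adds one
  edge.\<close>

locale glue =
  fixes A B :: "'a set" and EA EB :: "('a \<times> 'a) set" and a :: 'a and R :: "'a set"
  assumes disj: "A \<inter> B = {}"
    and EA: "EA \<subseteq> A \<times> A" and EB: "EB \<subseteq> B \<times> B"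
    and symA: "sym EA" and symB: "sym EB"
    and aA: "a \<in> A" and RB: "R \<subseteq> B"
    and finA: "finite A" and finB: "finite B"
begin

abbreviation "GE \<equiv> EA \<union> EB \<union> star a R"

lemma sym_GE: "sym GE"
  using symA symB sym_star[of a R] by (simp add: sym_Un)

lemma GE_cases:
  assumes "(u, v) \<in> GE"
  obtains "(u, v) \<in> EA" "u \<in> A" "v \<in> A" "u \<notin> B" "v \<notin> B"
    | "(u, v) \<in> EB" "u \<in> B" "v \<in> B" "u \<notin> A" "v \<notin> A"
    | "u = a" "v \<in> R" "v \<in> B" "v \<notin> A"
    | "v = a" "u \<in> R" "u \<in> B" "u \<notin> A"
  using assms EA EB RB aA disj unfolding star_def by blast

lemma conn_A: "S \<subseteq> A \<Longrightarrow> conn GE S \<longleftrightarrow> conn EA S"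
proof -
  assume S: "S \<subseteq> A"
  have "GE \<inter> S \<times> S = EA \<inter> S \<times> S"
    using S disj EB RB by (auto simp: star_def)
  then show ?thesis by (simp add: conn_def)
qed

lemma conn_B: "S \<subseteq> B \<Longrightarrow> conn GE S \<longleftrightarrow> conn EB S"
proof -
  assume S: "S \<subseteq> B"
  have "GE \<inter> S \<times> S = EB \<inter> S \<times> S"
    using S disj EA aA by (auto simp: star_def)
  then show ?thesis by (simp add: conn_def)
qed

text \<open>All edges between \<open>A\<close> and \<open>B\<close> end in \<open>a\<close>, so
  \<open>a\<close> separates the two sides. A walk leaving \<open>A\<close> must come back through
  \<open>a\<close>, and its excursions into \<open>B\<close> can be cut out.\<close>

lemma conn_mixedD:
  assumes S: "S \<subseteq> A \<union> B" "S \<inter> A \<noteq> {}" "S \<inter> B \<noteq> {}" and c: "conn GE S"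
  shows "a \<in> S" "conn EA (S \<inter> A)" "S \<inter> B \<in> att EB B R"
proof -
  let ?G = "GE \<inter> S \<times> S"
  obtain s t where st: "s \<in> S" "s \<in> A" "t \<in> S" "t \<in> B" using S by auto
  show aS: "a \<in> S"
  proof (rule ccontr)
    assume "a \<notin> S"
    have "(s, t) \<in> ?G\<^sup>*" using c st by (auto simp: conn_def)
    then have "t \<in> A"
    proof induction
      case base show ?case using st by simp
    next
      case (step y z)
      have yz: "y \<in> S" "z \<in> S" "(y, z) \<in> GE" using step(2) by auto
      from yz(3) show ?case
        by (cases rule: GE_cases) (use yz step.IH \<open>a \<notin> S\<close> in auto)
    qed
    then show False using st disj by auto
  qed
  show "conn EA (S \<inter> A)"
    unfolding conn_def
  proof (intro ballI)
    fix u v assume uv: "u \<in> S \<inter> A" "v \<in> S \<inter> A"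
    \<comment> \<open>Collapsing \<open>B\<close> to \<open>a\<close> turns each edge inside
      \<open>S\<close> into an edge of \<open>EA\<close> or into a trivial step.\<close>
    define h where "h z = (if z \<in> A then z else a)" for z
    have "(u, v) \<in> ?G\<^sup>*" using c uv by (auto simp: conn_def)
    then have "(h u, h v) \<in> (EA \<inter> (S \<inter> A) \<times> (S \<inter> A))\<^sup>*"
    proof (rule rtrancl_map)
      fix x y assume xy: "(x, y) \<in> ?G"
      then have "(x, y) \<in> GE" by simp
      then show "(h x, h y) \<in> (EA \<inter> (S \<inter> A) \<times> (S \<inter> A))\<^sup>*"
        by (cases rule: GE_cases) (use xy aA in \<open>auto simp: h_def\<close>)
    qed
    then show "(u, v) \<in> (EA \<inter> (S \<inter> A) \<times> (S \<inter> A))\<^sup>*"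
      using uv by (simp add: h_def)
  qed
  \<comment> \<open>Follow a walk from \<open>a\<close>: it can enter \<open>B\<close> only at a
    vertex of \<open>R\<close>, and until it returns to \<open>A\<close> it stays reachable from
    that vertex within \<open>S \<inter> B\<close>.\<close>
  have *: "z \<in> A \<or> (\<exists>r\<in>R \<inter> (S \<inter> B). (r, z) \<in> (EB \<inter> (S \<inter> B) \<times> (S \<inter> B))\<^sup>*)"
    if "(a, z) \<in> ?G\<^sup>*" for z
    using that
  proof induction
    case base show ?case using aA by simp
  next
    case (step y z)
    have yz: "y \<in> S" "z \<in> S" "(y, z) \<in> GE" using step(2) by auto
    from yz(3) show ?case
    proof (cases rule: GE_cases)
      case 2
      then obtain r where r: "r \<in> R \<inter> (S \<inter> B)" "(r, y) \<in> (EB \<inter> (S \<inter> B) \<times> (S \<inter> B))\<^sup>*"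
        using step.IH by blast
      then have "(r, z) \<in> (EB \<inter> (S \<inter> B) \<times> (S \<inter> B))\<^sup>*"
        using 2 yz by (auto intro: rtrancl_into_rtrancl)
      then show ?thesis using r by blast
    qed (use yz aA in auto)
  qed
  show "S \<inter> B \<in> att EB B R"
  proof -
    have "\<exists>r\<in>R \<inter> (S \<inter> B). (r, q) \<in> (EB \<inter> (S \<inter> B) \<times> (S \<inter> B))\<^sup>*" if "q \<in> S \<inter> B" for q
    proof -
      have "(a, q) \<in> ?G\<^sup>*" using c aS that by (auto simp: conn_def)
      from *[OF this] show ?thesis using that disj by blast
    qed
    then show ?thesis using S(3) by (auto simp: att_def)
  qed
qed

lemma conn_mixedI:
  assumes P: "P \<subseteq> A" "a \<in> P" "conn EA P" and Q: "Q \<in> att EB B R"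
  shows "conn GE (P \<union> Q)"
proof (rule conn_from_center[OF sym_GE])
  let ?G = "GE \<inter> (P \<union> Q) \<times> (P \<union> Q)"
  fix u assume "u \<in> P \<union> Q"
  then consider "u \<in> P" | "u \<in> Q" by blast
  then show "(a, u) \<in> ?G\<^sup>*"
  proof cases
    case 1
    then have "(a, u) \<in> (EA \<inter> P \<times> P)\<^sup>*" using P by (auto simp: conn_def)
    then show ?thesis by (rule rtrancl_mono[THEN subsetD, rotated]) auto
  next
    case 2
    then obtain r where r: "r \<in> R" "r \<in> Q" "(r, u) \<in> (EB \<inter> Q \<times> Q)\<^sup>*"
      using Q by (auto simp: att_def)
    then have "(r, u) \<in> ?G\<^sup>*" by (auto intro: rtrancl_mono[THEN subsetD, rotated])
    moreover have "(a, r) \<in> ?G" using r P by (auto simp: star_def)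
    ultimately show ?thesis by (rule converse_rtrancl_into_rtrancl[rotated])
  qed
qed

text \<open>A connected set lies in \<open>A\<close>, or in \<open>B\<close> (possible only for
  \<open>W = {}\<close>), or meets both. In the last case its two traces can be chosen
  independently: a connected set through \<open>a\<close> in \<open>A\<close> and an attachable set
  in \<open>B\<close>.\<close>

lemma csets_glue:
  assumes W: "W \<subseteq> A"
  shows "csets GE (A \<union> B) W = csets EA A W \<union> (if W = {} then csets EB B {} else {})
    \<union> (\<lambda>(P, Q). P \<union> Q) ` (csets EA A (insert a W) \<times> att EB B R)" (is "?L = ?R")
proof (intro equalityI subsetI)
  fix S assume S: "S \<in> ?L"
  then have S': "S \<noteq> {}" "W \<subseteq> S" "S \<subseteq> A \<union> B" "conn GE S" by (auto simp: csets_def)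
  consider "S \<inter> B = {}" | "S \<inter> A = {}" | "S \<inter> A \<noteq> {}" "S \<inter> B \<noteq> {}" by blast
  then show "S \<in> ?R"
  proof cases
    case 1
    then have "S \<subseteq> A" using S' by auto
    then show ?thesis using S' conn_A by (auto simp: csets_def)
  next
    case 2
    then have "S \<subseteq> B" "W = {}" using S' W by auto
    then show ?thesis using S' conn_B by (auto simp: csets_def)
  next
    case 3
    note m = conn_mixedD[OF S'(3) 3 S'(4)]
    have "S \<inter> A \<in> csets EA A (insert a W)"
      using m S' 3 W aA by (auto simp: csets_def)
    moreover have "S = (S \<inter> A) \<union> (S \<inter> B)" using S' by auto
    ultimately have "S \<in> (\<lambda>(P, Q). P \<union> Q) ` (csets EA A (insert a W) \<times> att EB B R)"
      using m(3) by (intro image_eqI[of _ _ "(S \<inter> A, S \<inter> B)"]) simp_all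
    then show ?thesis by blast
  qed
next
  fix S assume "S \<in> ?R"
  then consider "S \<in> csets EA A W" | "W = {}" "S \<in> csets EB B {}"
    | P Q where "P \<in> csets EA A (insert a W)" "Q \<in> att EB B R" "S = P \<union> Q"
    by (auto split: if_splits)
  then show "S \<in> ?L"
  proof cases
    case 1 then show ?thesis using conn_A by (auto simp: csets_def)
  next
    case 2 then show ?thesis using conn_B by (auto simp: csets_def)
  next
    case 3
    have "conn GE (P \<union> Q)" by (rule conn_mixedI) (use 3 in \<open>auto simp: csets_def\<close>)
    then show ?thesis using 3 by (auto simp: csets_def att_def)
  qed
qed

text \<open>The factor \<open>card (att EB B R)\<close> does not depend on the vertex
  \<open>a\<close> to which \<open>R\<close> is joined. Hence two gluings of the same pieces at
  different vertices can be compared through sets inside \<open>A\<close> alone.\<close>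

lemma count_glue:
  assumes W: "W \<subseteq> A"
  shows "count_conn GE (A \<union> B) W = count_conn EA A W + (if W = {} then count_conn EB B {} else 0)
    + count_conn EA A (insert a W) * card (att EB B R)"
proof -
  let ?C = "if W = {} then csets EB B {} else {}"
  let ?I = "(\<lambda>(P, Q). P \<union> Q) ` (csets EA A (insert a W) \<times> att EB B R)"
  have fa: "finite (att EB B R)"
    by (rule finite_subset[of _ "Pow B"]) (use finB in \<open>auto simp: att_def\<close>)
  have inj: "inj_on (\<lambda>(P, Q). P \<union> Q) (csets EA A (insert a W) \<times> att EB B R)"
  proof (rule inj_onI, clarify)
    fix P Q P' Q' assume *: "P \<in> csets EA A (insert a W)" "P' \<in> csets EA A (insert a W)"
      "Q \<in> att EB B R" "Q' \<in> att EB B R" "P \<union> Q = P' \<union> Q'"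
    then have "P \<subseteq> A" "P' \<subseteq> A" "Q \<subseteq> B" "Q' \<subseteq> B" by (auto simp: csets_def att_def)
    then show "P = P' \<and> Q = Q'" using *(5) disj by blast
  qed
  have cI: "card ?I = count_conn EA A (insert a W) * card (att EB B R)"
    by (simp add: card_image[OF inj] card_cartesian_product count_conn_def)
  have fin: "finite (csets EA A W)" "finite ?C" "finite ?I"
    using finA finB fa by (auto intro: finite_csets)
  have d1: "csets EA A W \<inter> ?C = {}"
    using disj by (auto simp: csets_def)
  have d2: "(csets EA A W \<union> ?C) \<inter> ?I = {}"
  proof -
    have "False" if "P \<in> csets EA A (insert a W)" "Q \<in> att EB B R" "P \<union> Q \<in> csets EA A W \<union> ?C" for P Q
    proof -
      have "a \<in> P \<union> Q" "\<exists>q. q \<in> Q \<and> q \<in> B" using that by (auto simp: csets_def att_def)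
      moreover have "P \<union> Q \<subseteq> A \<or> P \<union> Q \<subseteq> B"
        using that(3) by (auto simp: csets_def split: if_splits)
      ultimately show False using disj aA by blast
    qed
    then show ?thesis by (fastforce simp del: Un_iff)
  qed
  have "count_conn GE (A \<union> B) W = card (csets EA A W \<union> ?C \<union> ?I)"
    by (simp add: count_conn_def csets_glue[OF W])
  also have "\<dots> = card (csets EA A W) + card ?C + card ?I"
    using fin d1 d2 by (simp add: card_Un_disjoint)
  also have "card ?C = (if W = {} then count_conn EB B {} else 0)"
    by (simp add: count_conn_def)
  finally show ?thesis by (simp add: cI count_conn_def)
qed

end

section \<open>Trees\<close>

text \<open>Every edge is a bridge. Reachability passes easily through maps that collapse part of a
  graph, which suits surgery on trees better than cycles do; \<open>acyc_iff\<close> gives the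
  equivalence.\<close>

definition acyc :: "('a \<times> 'a) set \<Rightarrow> bool" where
  "acyc E \<longleftrightarrow> (\<forall>u v. (u, v) \<in> E \<longrightarrow> (u, v) \<notin> (E - {(u, v), (v, u)})\<^sup>*)"

definition is_tree :: "'a set \<Rightarrow> ('a \<times> 'a) set \<Rightarrow> bool" where
  "is_tree V E \<longleftrightarrow> finite V \<and> V \<noteq> {} \<and> E \<subseteq> V \<times> V \<and> sym E \<and> conn E V \<and> acyc E"

definition deg :: "('a \<times> 'a) set \<Rightarrow> 'a \<Rightarrow> nat" where
  "deg E v = card (E `` {v})"

lemma is_treeD:
  assumes "is_tree V E"
  shows "finite V" "V \<noteq> {}" "E \<subseteq> V \<times> V" "sym E" "acyc E" "finite E"
    "\<And>u v. u \<in> V \<Longrightarrow> v \<in> V \<Longrightarrow> (u, v) \<in> E\<^sup>*"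
proof -
  show *: "finite V" "V \<noteq> {}" "E \<subseteq> V \<times> V" "sym E" "acyc E"
    using assms by (auto simp: is_tree_def)
  show "finite E" using * by (meson finite_SigmaI finite_subset)
  fix u v assume uv: "u \<in> V" "v \<in> V"
  have "E \<inter> V \<times> V = E" using * by auto
  then show "(u, v) \<in> E\<^sup>*"
    using assms uv by (auto simp: is_tree_def conn_def)
qed

lemma is_treeI:
  assumes "finite V" "E \<subseteq> V \<times> V" "sym E" "acyc E" "a \<in> V" "\<And>u. u \<in> V \<Longrightarrow> (u, a) \<in> E\<^sup>*"
  shows "is_tree V E"
proof -
  have "E \<inter> V \<times> V = E" using assms by auto
  moreover have "(a, u) \<in> E\<^sup>*" if "u \<in> V" for u
    using assms(6)[OF that] assms(3) by (meson symD sym_rtrancl)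
  ultimately have "conn E V"
    by (intro conn_from_center[OF assms(3)]) simp
  then show ?thesis using assms by (auto simp: is_tree_def)
qed

lemma acyc_irrefl: "acyc E \<Longrightarrow> (u, u) \<notin> E"
  by (auto simp: acyc_def)

lemma sym_minus: "sym E \<Longrightarrow> sym (E - {(u, v), (v, u)})"
  by (auto simp: sym_def)

context glue
begin

text \<open>Walks of the old tree can be projected: onto \<open>A\<close> they connect
  \<open>A\<close>, and onto \<open>B\<close> with the attaching vertex replaced by \<open>u\<close>
  they connect the branches to \<open>u\<close>. A detour around an edge of the new graph would
  likewise project to a detour around an edge of the old one.\<close>

lemma tree_move:
  assumes T: "is_tree (A \<union> B) GE" and uA: "u \<in> A"
  shows "is_tree (A \<union> B) (EA \<union> EB \<union> star u R)" (is "is_tree _ ?E'")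
proof -
  define h where "h w z = (if z \<in> A then z else w)" for w z
  define k where "k w z = (if z \<in> B then z else w)" for w z
  have G': "glue A B EA EB u R" using uA glue_axioms by (auto simp: glue_def)
  have hEA: "(h w x, h w y) \<in> (EA - F)\<^sup>*" if "(x, y) \<in> EA \<union> EB \<union> star w R - F" "w \<in> A" for w x y F
  proof -
    have G': "glue A B EA EB w R" using that glue_axioms by (auto simp: glue_def)
    have xy: "(x, y) \<in> EA \<union> EB \<union> star w R" using that by blast
    then show ?thesis
      by (cases rule: glue.GE_cases[OF G', OF xy]) (use that in \<open>auto simp: h_def\<close>)
  qed
  have kEB: "(k w' x, k w' y) \<in> (EB \<union> star w' R)\<^sup>*" if "(x, y) \<in> EA \<union> EB \<union> star w R" "w \<in> A" for w w' x y
  proof -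
    have G': "glue A B EA EB w R" using that glue_axioms by (auto simp: glue_def)
    show ?thesis
      by (cases rule: glue.GE_cases[OF G', OF that(1)]) (use that disj in \<open>auto simp: k_def star_def\<close>)
  qed
  have reach: "(z, u) \<in> ?E'\<^sup>*" if "z \<in> A \<union> B" for z
  proof (cases "z \<in> A")
    case True
    have "(z, u) \<in> GE\<^sup>*" using is_treeD(7)[OF T] that uA by blast
    then have "(h a z, h a u) \<in> EA\<^sup>*"
      by (rule rtrancl_map) (use hEA[of _ _ a "{}"] aA in auto)
    then have "(z, u) \<in> EA\<^sup>*" using True uA by (simp add: h_def)
    then show ?thesis by (rule rtrancl_mono[THEN subsetD, rotated]) auto
  next
    case False
    then have zB: "z \<in> B" using that by blast
    have "(z, a) \<in> GE\<^sup>*" using is_treeD(7)[OF T] that aA by blast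
    then have "(k u z, k u a) \<in> (EB \<union> star u R)\<^sup>*"
      by (rule rtrancl_map) (rule kEB, use aA in auto)
    moreover have "k u z = z" "k u a = u" using zB aA disj by (auto simp: k_def)
    ultimately have "(z, u) \<in> (EB \<union> star u R)\<^sup>*" by simp
    then show ?thesis by (rule rtrancl_mono[THEN subsetD, rotated]) auto
  qed
  have acycE: "acyc GE" using T is_treeD by blast
  have "acyc ?E'"
    unfolding acyc_def
  proof (intro allI impI notI)
    fix s t assume st: "(s, t) \<in> ?E'" and path: "(s, t) \<in> (?E' - {(s, t), (t, s)})\<^sup>*"
    show False
    proof (cases "(s, t) \<in> EA")
      case True
      have "(h u s, h u t) \<in> (EA - {(s, t), (t, s)})\<^sup>*"
        using path by (rule rtrancl_map) (use hEA[OF _ uA] in auto)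
      then have "(s, t) \<in> (EA - {(s, t), (t, s)})\<^sup>*"
        using True EA by (auto simp: h_def)
      then have "(s, t) \<in> (GE - {(s, t), (t, s)})\<^sup>*"
        by (rule rtrancl_mono[THEN subsetD, rotated]) auto
      then show False using acycE True by (auto simp: acyc_def)
    next
      case False
      then have st': "(s, t) \<in> EB \<union> star u R" using st by blast
      have sub: "EB \<union> star u R \<subseteq> insert u B \<times> insert u B"
        using EB RB by (auto simp: star_def)
      then have st'': "s \<in> insert u B" "t \<in> insert u B" using st' by auto
      \<comment> \<open>\<open>k a\<close> collapses \<open>A\<close> and replaces \<open>u\<close>
        by \<open>a\<close>. Being injective on \<open>insert u B\<close>, it sends no other edge to
        the image of the edge under consideration.\<close>
      have inj: "k a i = k a j \<longleftrightarrow> i = j" if "i \<in> insert u B" "j \<in> insert u B" for i j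
        using that aA uA disj by (auto simp: k_def)
      have to_GE: "(k a i, k a j) \<in> GE" if "(i, j) \<in> EB \<union> star u R" for i j
        using that EB RB aA uA disj by (auto simp: k_def star_def)
      let ?F = "{(k a s, k a t), (k a t, k a s)}"
      have "(k a s, k a t) \<in> (GE - ?F)\<^sup>*"
        using path
      proof (rule rtrancl_map)
        fix x y assume "(x, y) \<in> ?E' - {(s, t), (t, s)}"
        then have xy: "(x, y) \<in> ?E'" "(x, y) \<noteq> (s, t)" "(x, y) \<noteq> (t, s)" by auto
        show "(k a x, k a y) \<in> (GE - ?F)\<^sup>*"
        proof (cases "(x, y) \<in> EA")
          case True
          then show ?thesis using EA disj by (auto simp: k_def)
        next
          case False
          then have xy': "(x, y) \<in> EB \<union> star u R" using xy by blast
          then have "x \<in> insert u B" "y \<in> insert u B" using sub by auto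
          then have "(k a x, k a y) \<notin> ?F"
            using xy st'' inj[of x s] inj[of x t] inj[of y s] inj[of y t] by auto
          then show ?thesis using to_GE[OF xy'] by blast
        qed
      qed
      then show False using acycE to_GE[OF st'] unfolding acyc_def by blast
    qed
  qed
  moreover have "sym ?E'" using glue.sym_GE[OF G'] .
  moreover have "?E' \<subseteq> (A \<union> B) \<times> (A \<union> B)" using EA EB RB uA by (auto simp: star_def)
  ultimately show ?thesis
    using finA finB uA reach by (intro is_treeI[of _ _ u]) auto
qed

end

section \<open>Rooted trees and their branches\<close>

locale rooted =
  fixes V :: "'a set" and E :: "('a \<times> 'a) set" and r :: 'a
    and p :: "'a \<Rightarrow> 'a" and dep :: "'a \<Rightarrow> nat"
  assumes tree: "is_tree V E" and rV: "r \<in> V"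
    and par: "\<And>x. x \<in> V \<Longrightarrow> x \<noteq> r \<Longrightarrow> (x, p x) \<in> E \<and> dep x = Suc (dep (p x))"
    and edge: "\<And>x y. (x, y) \<in> E \<Longrightarrow> y \<noteq> r \<and> x = p y \<or> x \<noteq> r \<and> y = p x"

text \<open>Take distances from \<open>r\<close> as depths and a neighbour one step closer as
  parent. Since every edge is a bridge, this neighbour is unique and no edge joins vertices of equal
  depth.\<close>

lemma rooted_exists:
  assumes T: "is_tree V E" and r: "r \<in> V"
  shows "\<exists>p dep. rooted V E r p dep"
proof -
  note TD = is_treeD[OF T]
  define dep where "dep z = (LEAST n. (r, z) \<in> E ^^ n)" for z
  have dep1: "(r, z) \<in> E ^^ dep z" if "z \<in> V" for z
    unfolding dep_def using TD(7)[OF r that] by (auto dest!: rtrancl_imp_relpow intro: LeastI)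
  have dep2: "dep z \<le> n" if "(r, z) \<in> E ^^ n" for z n
    unfolding dep_def using that by (rule Least_le)
  have dep_r: "dep r = 0" using dep2[of r 0] by simp
  have dep0: "z = r" if "z \<in> V" and "dep z = 0" for z using dep1[of z] that by simp
  have edep: "dep v \<le> Suc (dep u)" if "(u, v) \<in> E" for u v
  proof (rule dep2)
    have "u \<in> V" using that TD by auto
    from dep1[OF this] that show "(r, v) \<in> E ^^ Suc (dep u)" by (rule relpow_Suc_I)
  qed
  have ex: "\<exists>w. (w, z) \<in> E \<and> dep z = Suc (dep w)" if zV: "z \<in> V" and zr: "z \<noteq> r" for z
  proof -
    obtain n where n: "dep z = Suc n" using dep0[OF zV] zr by (cases "dep z") auto
    then obtain w where w: "(r, w) \<in> E ^^ n" "(w, z) \<in> E" using dep1[OF zV] by auto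
    then have "dep z = Suc (dep w)" using dep2[OF w(1)] edep[OF w(2)] n by simp
    then show ?thesis using w by blast
  qed
  define p where "p z = (SOME w. (w, z) \<in> E \<and> dep z = Suc (dep w))" for z
  have p: "(p z, z) \<in> E \<and> dep z = Suc (dep (p z))" if "z \<in> V" "z \<noteq> r" for z
    unfolding p_def by (rule someI_ex[OF ex[OF that]])
  have p': "(z, p z) \<in> E" if "z \<in> V" "z \<noteq> r" for z
    using p[OF that] TD(4) by (meson symD)
  \<comment> \<open>The side conditions make visible which edges a shortest walk avoids: it never
    visits a vertex deeper than \<open>z\<close>, and each of its steps increases the depth.\<close>
  have path: "z \<in> V \<Longrightarrow> (r, z) \<in> (E \<inter> {(u, v). dep v \<le> dep z \<and> dep v = Suc (dep u)})\<^sup>*" for z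
  proof (induction "dep z" arbitrary: z)
    case 0
    then show ?case using dep0 by auto
  next
    case (Suc n)
    then have "z \<noteq> r" using dep_r by auto
    note pz = p[OF Suc(3) this]
    have "dep (p z) = n" "p z \<in> V" using pz Suc(2) TD by auto
    then have "(r, p z) \<in> (E \<inter> {(u, v). dep v \<le> dep (p z) \<and> dep v = Suc (dep u)})\<^sup>*"
      using Suc(1)[of "p z"] by simp
    then have "(r, p z) \<in> (E \<inter> {(u, v). dep v \<le> dep z \<and> dep v = Suc (dep u)})\<^sup>*"
      by (rule rtrancl_mono[THEN subsetD, rotated]) (use pz in auto)
    then show ?case by (rule rtrancl_into_rtrancl) (use pz in auto)
  qed
  have key: "x \<noteq> r \<and> q = p x" if xq: "(x, q) \<in> E" and le: "dep q \<le> dep x" for x q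
  proof
    have V: "x \<in> V" "q \<in> V" using xq TD by auto
    have ne: "x \<noteq> q" using xq acyc_irrefl[OF TD(5)] by auto
    show xr: "x \<noteq> r"
      using le dep_r dep0[OF V(2)] ne by auto
    note px = p[OF V(1) xr]
    have "p x \<in> V" using px TD by auto
    \<comment> \<open>Otherwise \<open>x\<close>, \<open>p x\<close>, up to \<open>r\<close> and
      down to \<open>q\<close> is a detour around the edge between \<open>x\<close> and
      \<open>q\<close>.\<close>
    show "q = p x"
    proof (rule ccontr)
      assume "q \<noteq> p x"
      let ?F = "E - {(x, q), (q, x)}"
      have sF: "sym (?F\<^sup>*)" by (rule sym_rtrancl[OF sym_minus[OF TD(4)]])
      have "(r, q) \<in> ?F\<^sup>*"
        using path[OF V(2)] by (rule rtrancl_mono[THEN subsetD, rotated]) (use le in auto)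
      moreover have "(r, p x) \<in> ?F\<^sup>*"
        using path[OF \<open>p x \<in> V\<close>] by (rule rtrancl_mono[THEN subsetD, rotated]) (use px le in auto)
      then have "(p x, r) \<in> ?F\<^sup>*" using sF by (meson symD)
      moreover have "(x, p x) \<in> ?F\<^sup>*"
        using p'[OF V(1) xr] \<open>q \<noteq> p x\<close> ne by (intro r_into_rtrancl) simp
      ultimately have "(x, q) \<in> ?F\<^sup>*" by (meson rtrancl_trans)
      then show False using TD(5) xq by (auto simp: acyc_def)
    qed
  qed
  have "rooted V E r p dep"
  proof
    fix x y assume xy: "(x, y) \<in> E"
    then have yx: "(y, x) \<in> E" using TD(4) by (meson symD)
    show "y \<noteq> r \<and> x = p y \<or> x \<noteq> r \<and> y = p x"
      using key[OF xy] key[OF yx] nat_le_linear by blast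
  qed (use T r p p' in simp_all)
  then show ?thesis by blast
qed

context rooted
begin

lemmas TD = is_treeD[OF tree]

definition children :: "'a \<Rightarrow> 'a set" where
  "children v = {x \<in> V. x \<noteq> r \<and> p x = v}"

definition desc :: "'a \<Rightarrow> 'a set" where
  "desc x = {z. (z, x) \<in> {(c, p c) | c. c \<in> V \<and> c \<noteq> r}\<^sup>*}"

lemma parV: "x \<in> V \<Longrightarrow> x \<noteq> r \<Longrightarrow> p x \<in> V"
  using par TD(3) by blast

lemma edge_iff: "(x, y) \<in> E \<longleftrightarrow> x \<in> children y \<or> y \<in> children x"
proof
  assume "(x, y) \<in> E"
  then show "x \<in> children y \<or> y \<in> children x"
    using edge[of x y] TD(3) by (auto simp: children_def)
next
  assume "x \<in> children y \<or> y \<in> children x"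
  then show "(x, y) \<in> E"
    using par symD[OF TD(4)] by (auto simp: children_def)
qed

lemma children_subset: "children v \<subseteq> V" by (auto simp: children_def)

lemma finite_children: "finite (children v)"
  using finite_subset[OF children_subset TD(1)] .

lemma children_dep: "c \<in> children v \<Longrightarrow> dep c = Suc (dep v)"
  using par by (auto simp: children_def)

lemma nbr_eq:
  assumes "v \<in> V"
  shows "E `` {v} = (if v = r then children v else insert (p v) (children v))"
  using assms by (auto simp: edge_iff) (auto simp: children_def)

lemma deg_root: "deg E r = card (children r)"
  using nbr_eq[OF rV] by (simp add: deg_def)

lemma deg_nonroot: "v \<in> V \<Longrightarrow> v \<noteq> r \<Longrightarrow> deg E v = Suc (card (children v))"
proof -
  assume v: "v \<in> V" "v \<noteq> r"
  have "p v \<notin> children v" using children_dep[of "p v" v] par[OF v] by auto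
  then show ?thesis using nbr_eq[OF v(1)] v finite_children by (simp add: deg_def)
qed

lemma desc_self: "x \<in> desc x" by (simp add: desc_def)

lemma desc_subset: "x \<in> V \<Longrightarrow> desc x \<subseteq> V"
proof
  fix z assume "x \<in> V" "z \<in> desc x"
  then show "z \<in> V" unfolding desc_def
    by (auto elim: converse_rtranclE)
qed

lemma desc_child: "c \<in> children z \<Longrightarrow> z \<in> desc x \<Longrightarrow> c \<in> desc x"
  unfolding desc_def children_def by (auto intro: converse_rtrancl_into_rtrancl)

lemma desc_trans: "z \<in> desc y \<Longrightarrow> y \<in> desc x \<Longrightarrow> z \<in> desc x"
  unfolding desc_def by (auto intro: rtrancl_trans)

lemma desc_parent: "z \<in> desc x \<Longrightarrow> z \<noteq> x \<Longrightarrow> z \<in> V \<and> z \<noteq> r \<and> p z \<in> desc x"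
  unfolding desc_def by (auto elim: converse_rtranclE)

lemma desc_dep: "z \<in> desc x \<Longrightarrow> dep x \<le> dep z \<and> (z \<noteq> x \<longrightarrow> dep x < dep z)"
  unfolding desc_def mem_Collect_eq
  by (induction rule: converse_rtrancl_induct) (use par in \<open>auto\<close>)

text \<open>Only the edge to the parent leads out of a branch, so \<open>desc x\<close> is one of
  the two components left by removing that edge. This supplies the hypotheses on leaving edges in
  \<open>opt_exchange\<close>.\<close>

lemma desc_leave:
  assumes "(s, t) \<in> E" "s \<in> desc x" "t \<notin> desc x"
  shows "s = x \<and> t = p x \<and> x \<noteq> r \<and> x \<in> V"
proof -
  have "s \<in> children t" using assms desc_child[of t s x] by (auto simp: edge_iff)
  then have "p s = t" "s \<noteq> r" "s \<in> V" by (auto simp: children_def)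
  then show ?thesis using desc_parent[OF assms(2)] assms(3) by blast
qed

lemma desc_enter:
  assumes "(s, t) \<in> E" "s \<notin> desc x" "t \<in> desc x"
  shows "s = p x \<and> t = x \<and> x \<noteq> r \<and> x \<in> V"
  using desc_leave[of t s x] assms symD[OF TD(4)] by blast

lemma parent_notin_desc: "x \<in> V \<Longrightarrow> x \<noteq> r \<Longrightarrow> p x \<notin> desc x"
  using desc_dep[of "p x" x] par[of x] by auto

lemma desc_cases:
  assumes "y \<in> desc x" "y \<noteq> x"
  obtains c where "c \<in> children x" "y \<in> desc c"
proof -
  have "(y, x) \<in> {(c, p c) | c. c \<in> V \<and> c \<noteq> r}\<^sup>*" using assms by (simp add: desc_def)
  then show thesis using assms(2)
    by (cases rule: rtranclE) (use that in \<open>auto simp: children_def desc_def\<close>)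
qed

lemma desc_linear:
  assumes "z \<in> desc x" "z \<in> desc y"
  shows "x \<in> desc y \<or> y \<in> desc x"
proof -
  have "(z, x) \<in> {(c, p c) | c. c \<in> V \<and> c \<noteq> r}\<^sup>*" using assms by (simp add: desc_def)
  then show ?thesis using assms(2)
  proof (induction rule: converse_rtrancl_induct)
    case base then show ?case by blast
  next
    case (step c z)
    then show ?case
      using desc_parent[of c y] desc_self desc_child[of c "p c" x]
      by (cases "c = y") (auto simp: desc_def intro: converse_rtrancl_into_rtrancl)
  qed
qed

end

section \<open>Exchange operations on optimal trees\<close>

definition degs :: "'a set \<Rightarrow> ('a \<times> 'a) set \<Rightarrow> nat multiset" where
  "degs V E = image_mset (deg E) (mset_set V)"

text \<open>Competitors share the vertex set, so there are finitely many. On a fixed vertex set,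
  comparing full degree multisets, leaves included, amounts to comparing degree sequences.\<close>

definition opt :: "'a set \<Rightarrow> ('a \<times> 'a) set \<Rightarrow> bool" where
  "opt V E \<longleftrightarrow> is_tree V E \<and>
     (\<forall>E'. is_tree V E' \<and> degs V E' = degs V E \<longrightarrow> count_conn E' V {} \<le> count_conn E V {})"

lemma optD: "opt V E \<Longrightarrow> is_tree V E"
  "opt V E \<Longrightarrow> is_tree V E' \<Longrightarrow> degs V E' = degs V E \<Longrightarrow> count_conn E' V {} \<le> count_conn E V {}"
  by (auto simp: opt_def)

lemma count_conn_pos: "finite V \<Longrightarrow> v \<in> V \<Longrightarrow> 0 < count_conn E V {v}"
proof -
  assume *: "finite V" "v \<in> V"
  then have "{v} \<in> csets E V {v}" by (auto simp: csets_def conn_def)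
  then show ?thesis using finite_csets[OF *(1)] by (auto simp: count_conn_def card_gt_0_iff)
qed

lemma count_conn_pair_less:
  assumes "finite V" "v \<in> V" "u \<noteq> v"
  shows "count_conn E V {v, u} < count_conn E V {v}"
  unfolding count_conn_def
proof (rule psubset_card_mono[OF finite_csets[OF assms(1)]])
  have "{v} \<in> csets E V {v}" "{v} \<notin> csets E V {v, u}"
    using assms by (auto simp: csets_def conn_def)
  moreover have "csets E V {v, u} \<subseteq> csets E V {v}" by (auto simp: csets_def)
  ultimately show "csets E V {v, u} \<subset> csets E V {v}" by blast
qed

lemma (in glue) deg_glue:
  "deg GE z = deg (EA \<union> EB) z + (if z = a then card R else 0) + (if z \<in> R then 1 else 0)"
proof -
  have fin: "finite ((EA \<union> EB) `` {z})"
    by (rule finite_subset[of _ "A \<union> B"]) (use EA EB finA finB in auto)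
  have finR: "finite R" using RB finB finite_subset by blast
  have aR: "a \<notin> R" using RB aA disj by blast
  have "GE `` {z} = (EA \<union> EB) `` {z} \<union> star a R `` {z}" by auto
  moreover have "(EA \<union> EB) `` {z} \<inter> star a R `` {z} = {}"
    using EA EB RB aA disj by (auto simp: star_def)
  moreover have "star a R `` {z} = (if z = a then R else if z \<in> R then {a} else {})"
    using aR by (auto simp: star_def)
  ultimately show ?thesis
    using fin finR aR by (auto simp: deg_def card_Un_disjoint)
qed

text \<open>The two trees differ only in where the branches \<open>B\<close> hang, so optimality
  compares \<open>u\<close> and \<open>v\<close> inside the remaining part \<open>A\<close> and
  gives a weak inequality there. Adding the branches makes it strict: they extend every set through
  \<open>v\<close>, but only those sets through \<open>u\<close> that contain \<open>v\<close> as
  well.\<close>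

lemma opt_deg_less:
  assumes opt: "opt V E" and uv: "u \<in> V" "v \<in> V" and less: "deg E u < deg E v"
  shows "count_conn E V {u} < count_conn E V {v}"
proof -
  \<comment> \<open>Rooting at \<open>u\<close> keeps \<open>u\<close> out of all branches below
    \<open>v\<close>. One edge of \<open>v\<close> leads towards \<open>u\<close>, and as
    \<open>deg E u\<close> is positive, enough children remain to be moved.\<close>
  obtain p dep where "rooted V E u p dep"
    using rooted_exists[OF optD(1)[OF opt] uv(1)] by blast
  then interpret rooted V E u p dep .
  have vu: "v \<noteq> u" using less by auto
  define k where "k = deg E v - deg E u"
  have "0 < deg E u"
  proof -
    obtain w where "(u, w) \<in> E" using TD(7)[OF uv] vu by (auto elim: converse_rtranclE)
    moreover have "finite (E `` {u})" using TD(6) by (rule finite_Image)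
    ultimately show ?thesis by (auto simp: deg_def card_gt_0_iff)
  qed
  then have "k \<le> card (children v)"
    using deg_nonroot[OF uv(2) vu] by (simp add: k_def)
  then obtain R where R: "R \<subseteq> children v" "card R = k"
    by (meson obtain_subset_with_card_n)
  have Rc: "c \<in> V" "c \<noteq> u" "p c = v" if "c \<in> R" for c
    using R that by (auto simp: children_def)
  define B where "B = (\<Union>c\<in>R. desc c)"
  define A where "A = V - B"
  have BV: "B \<subseteq> V" unfolding B_def using Rc(1) desc_subset by blast
  have VAB: "V = A \<union> B" using BV by (auto simp: A_def)
  have "v \<notin> B"
    unfolding B_def using Rc parent_notin_desc by blast
  moreover have "u \<notin> B"
    unfolding B_def using Rc(2) desc_parent by blast
  ultimately have vA: "v \<in> A" and uA: "u \<in> A" using uv by (auto simp: A_def)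
  define EA where "EA = E \<inter> A \<times> A"
  define EB where "EB = E \<inter> B \<times> B"
  interpret glue A B EA EB v R
  proof
    show "R \<subseteq> B" using desc_self by (auto simp: B_def)
  qed (use vA TD(1,4) BV finite_subset in \<open>auto simp: A_def EA_def EB_def intro: sym_restrict\<close>)
  interpret g': glue A B EA EB u R
    using uA glue_axioms by (auto simp: glue_def)
  have cross: "s = v \<and> t \<in> R" if "(s, t) \<in> E" "s \<notin> B" "t \<in> B" for s t
  proof -
    obtain c where c: "c \<in> R" "t \<in> desc c" using \<open>t \<in> B\<close> by (auto simp: B_def)
    then have "s \<notin> desc c" using \<open>s \<notin> B\<close> by (auto simp: B_def)
    from desc_enter[OF that(1) this c(2)] show ?thesis using Rc[OF c(1)] c by auto
  qed
  have E_eq: "E = GE"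
  proof (intro equalityI subrelI)
    fix s t assume st: "(s, t) \<in> E"
    then have ts: "(t, s) \<in> E" using TD(4) by (meson symD)
    have "s \<in> A \<union> B" "t \<in> A \<union> B" using st TD(3) VAB by auto
    then show "(s, t) \<in> GE"
      using st cross[OF st] cross[OF ts] disj unfolding EA_def EB_def star_def by blast
  next
    fix s t assume "(s, t) \<in> GE"
    then show "(s, t) \<in> E"
      using R(1) edge_iff by (auto simp: EA_def EB_def star_def)
  qed
  let ?E' = "g'.GE"
  have T': "is_tree V ?E'"
    using tree_move[OF _ uA] tree E_eq VAB by simp
  have uR: "u \<notin> R" "v \<notin> R" using RB uA vA disj by auto
  have du: "deg ?E' u = deg E v" and dv: "deg ?E' v = deg E u"
    and dz: "z \<noteq> u \<Longrightarrow> z \<noteq> v \<Longrightarrow> deg ?E' z = deg E z" for z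
    using g'.deg_glue deg_glue[folded E_eq] uR vu R(2) less by (auto simp: k_def)
  have "degs V ?E' = degs V E"
  proof -
    have V: "mset_set V = add_mset u (add_mset v (mset_set (V - {u} - {v})))"
      using uv vu TD(1) by (metis finite_Diff insertCI insert_Diff insert_iff mset_set.remove)
    have "image_mset (deg ?E') (mset_set (V - {u} - {v})) = image_mset (deg E) (mset_set (V - {u} - {v}))"
      using TD(1) by (intro image_mset_cong) (auto simp: dz)
    then show ?thesis by (simp add: degs_def V du dv add_mset_commute)
  qed
  \<comment> \<open>The counts inside \<open>A\<close> and inside \<open>B\<close> agree for both
    trees, so only the products remain; their common factor is positive and can be
    cancelled.\<close>
  from optD(2)[OF opt T' this]
  have "count_conn EA A {u} * card (att EB B R) \<le> count_conn EA A {v} * card (att EB B R)"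
    using count_glue[of "{}"] g'.count_glue[of "{}"] by (simp add: E_eq[symmetric] VAB[symmetric])
  moreover have "0 < card (att EB B R)"
  proof -
    have "0 < k" using less by (simp add: k_def)
    then obtain c where "c \<in> R" using R(2) by fastforce
    then have "{c} \<in> att EB B R" using RB by (auto simp: att_def)
    moreover have "finite (att EB B R)"
      by (rule finite_subset[of _ "Pow B"]) (use finB in \<open>auto simp: att_def\<close>)
    ultimately show ?thesis by (auto simp: card_gt_0_iff)
  qed
  ultimately have le: "count_conn EA A {u} \<le> count_conn EA A {v}" by simp
  have "count_conn E V {u} = count_conn EA A {u} + count_conn EA A {v, u} * card (att EB B R)"
    using count_glue[of "{u}"] uA by (simp add: E_eq[symmetric] VAB[symmetric])
  also have "\<dots> < count_conn EA A {v} + count_conn EA A {v} * card (att EB B R)"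
    using le count_conn_pair_less[OF finA vA vu[symmetric], of EA] \<open>0 < card (att EB B R)\<close>
    by (intro add_le_less_mono) auto
  also have "\<dots> = count_conn E V {v}"
    using count_glue[of "{v}"] vA by (simp add: E_eq[symmetric] VAB[symmetric])
  finally show ?thesis .
qed

text \<open>A single edge can be read from either end, so the last formula is the third with the
  sides swapped. For one attaching vertex, \<open>att\<close> reduces to the connected sets through
  it.\<close>

lemma count_edge_glue:
  assumes "glue A B EA EB a {b}"
  shows "count_conn (EA \<union> EB \<union> star a {b}) (A \<union> B) {} =
      count_conn EA A {} + count_conn EB B {} + count_conn EA A {a} * count_conn EB B {b}"
    and "W \<subseteq> A \<Longrightarrow> W \<noteq> {} \<Longrightarrow> count_conn (EA \<union> EB \<union> star a {b}) (A \<union> B) W =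
      count_conn EA A W + count_conn EA A (insert a W) * count_conn EB B {b}"
    and "count_conn (EA \<union> EB \<union> star a {b}) (A \<union> B) {a} =
      count_conn EA A {a} * (1 + count_conn EB B {b})"
    and "count_conn (EA \<union> EB \<union> star a {b}) (A \<union> B) {b} =
      count_conn EB B {b} * (1 + count_conn EA A {a})"
proof -
  interpret glue A B EA EB a "{b}" by fact
  interpret h: glue B A EB EA b "{a}"
    using glue_axioms by (auto simp: glue_def)
  have eq: "h.GE = GE" "B \<union> A = A \<union> B" by (auto simp: star_def)
  have att: "card (att EB B {b}) = count_conn EB B {b}" "card (att EA A {a}) = count_conn EA A {a}"
    using att_singleton[OF symB] att_singleton[OF symA] by (simp_all add: count_conn_def)
  show "count_conn GE (A \<union> B) {} =
      count_conn EA A {} + count_conn EB B {} + count_conn EA A {a} * count_conn EB B {b}"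
    using count_glue[of "{}"] att by simp
  show "W \<subseteq> A \<Longrightarrow> W \<noteq> {} \<Longrightarrow> count_conn GE (A \<union> B) W =
      count_conn EA A W + count_conn EA A (insert a W) * count_conn EB B {b}"
    using count_glue[of W] att by simp
  show "count_conn GE (A \<union> B) {a} = count_conn EA A {a} * (1 + count_conn EB B {b})"
    using count_glue[of "{a}"] att aA by simp
  show "count_conn GE (A \<union> B) {b} = count_conn EB B {b} * (1 + count_conn EA A {a})"
    using h.count_glue[of "{b}"] att h.aA eq by simp
qed

text \<open>Here \<open>a\<close>, \<open>b\<close> stand for f_X(x), f_Y(y), \<open>p\<close>,
  \<open>q\<close> for the counts through \<open>x'\<close>, \<open>y'\<close> in the middle part
  and \<open>c\<close> for the count through both. The hypothesis says
  \<open>(a - b) * (p - q) \<ge> 0\<close>, and both differences in question are combinations of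
  \<open>a - b\<close> and \<open>p - q\<close> with positive coefficients, so their signs
  agree.\<close>

lemma exchange_arith:
  fixes a b c p q :: int
  assumes opt: "b * p + a * q \<le> b * q + a * p" and pos: "0 < a" "0 < b" and c: "0 \<le> c" "c < p" "c < q"
  shows "a * (1 + (p + c * b)) < b * (1 + (q + c * a)) \<longleftrightarrow> (p + c * b) * (1 + a) < (q + c * a) * (1 + b)"
proof -
  have s: "0 \<le> (a - b) * (p - q)" using opt by (simp add: algebra_simps)
  have d1: "a * (1 + (p + c * b)) - b * (1 + (q + c * a)) = (a - b) * (1 + p) + b * (p - q)"
    by (simp add: algebra_simps)
  have d2: "(p + c * b) * (1 + a) - (q + c * a) * (1 + b) = (p - q) * (1 + b) + (a - b) * (p - c)"
    by (simp add: algebra_simps)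
  consider "b < a" | "a = b" | "a < b" by linarith
  then show ?thesis
  proof cases
    case 1
    then have "q \<le> p" using s by (simp add: zero_le_mult_iff)
    then have "0 \<le> (a - b) * (1 + p)" "0 \<le> b * (p - q)" "0 \<le> (p - q) * (1 + b)" "0 \<le> (a - b) * (p - c)"
      using 1 pos c by (simp_all add: mult_nonneg_nonneg)
    then show ?thesis using d1 d2 by linarith
  next
    case 2
    then have "a * (1 + (p + c * b)) < b * (1 + (q + c * a)) \<longleftrightarrow> p < q"
      "(p + c * b) * (1 + a) < (q + c * a) * (1 + b) \<longleftrightarrow> p < q"
      using d1 d2 pos by (simp_all add: mult.commute)
    then show ?thesis by simp
  next
    case 3
    then have "p \<le> q" using s by (simp add: zero_le_mult_iff)
    have "(a - b) * (1 + p) < 0" "(a - b) * (p - c) < 0"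
      using 3 c by (simp_all add: mult_neg_pos)
    moreover have "b * (p - q) \<le> 0" "(p - q) * (1 + b) \<le> 0"
      using \<open>p \<le> q\<close> pos by (simp_all add: mult_nonneg_nonpos mult_nonpos_nonneg)
    ultimately show ?thesis using d1 d2 by linarith
  qed
qed

lemma deg_edge_glue:
  assumes "glue A B EA EB a {b}"
  shows "deg (EA \<union> EB \<union> star a {b}) z =
      deg (EA \<union> EB) z + (if z = a then 1 else 0) + (if z = b then 1 else 0)"
  using glue.deg_glue[OF assms, of z] by simp

text \<open>\<open>X\<close> and \<open>Y\<close> hang from the middle part at \<open>x'\<close> and
  \<open>y'\<close>. Swapping the two attachments preserves all degrees, so optimality makes the
  gain nonpositive, which is the hypothesis of \<open>exchange_arith\<close>.\<close>

lemma opt_exchange: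
  assumes opt: "opt V E"
    and XY: "X \<subseteq> V" "Y \<subseteq> V" "X \<inter> Y = {}" "x \<in> X" "y \<in> Y"
    and x': "x' \<in> V" "x' \<notin> X" "x' \<notin> Y" and y': "y' \<in> V" "y' \<notin> X" "y' \<notin> Y" and ne: "x' \<noteq> y'"
    and e: "(x, x') \<in> E" "(y, y') \<in> E"
    and leaveX: "\<And>s t. (s, t) \<in> E \<Longrightarrow> s \<in> X \<Longrightarrow> t \<notin> X \<Longrightarrow> s = x \<and> t = x'"
    and leaveY: "\<And>s t. (s, t) \<in> E \<Longrightarrow> s \<in> Y \<Longrightarrow> t \<notin> Y \<Longrightarrow> s = y \<and> t = y'"
  shows "count_conn E V {x} < count_conn E V {y} \<longleftrightarrow> count_conn E V {x'} < count_conn E V {y'}"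
proof -
  note T = is_treeD[OF optD(1)[OF opt]]
  define M where "M = V - X - Y"
  define FX where "FX = E \<inter> X \<times> X"
  define FY where "FY = E \<inter> Y \<times> Y"
  define FM where "FM = E \<inter> M \<times> M"
  have fin: "finite X" "finite Y" "finite M"
    using T(1) XY finite_subset by (auto simp: M_def)
  have sub: "FX \<subseteq> X \<times> X" "FY \<subseteq> Y \<times> Y" "FM \<subseteq> M \<times> M" by (auto simp: FX_def FY_def FM_def)
  have sy: "sym FX" "sym FY" "sym FM" using T(4) by (auto simp: FX_def FY_def FM_def intro: sym_restrict)
  have d: "M \<inter> X = {}" "M \<inter> Y = {}" by (auto simp: M_def)
  have inM: "x' \<in> M" "y' \<in> M" using x' y' by (auto simp: M_def)
  have E_eq: "E = FM \<union> FX \<union> FY \<union> star x' {x} \<union> star y' {y}"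
  proof (intro equalityI subrelI)
    fix s t assume st: "(s, t) \<in> E"
    then have ts: "(t, s) \<in> E" using T(4) by (meson symD)
    have "s \<in> M \<union> X \<union> Y" "t \<in> M \<union> X \<union> Y" using st T(3) by (auto simp: M_def)
    then show "(s, t) \<in> FM \<union> FX \<union> FY \<union> star x' {x} \<union> star y' {y}"
      using st leaveX[OF st] leaveX[OF ts] leaveY[OF st] leaveY[OF ts] d XY(3)
      unfolding FM_def FX_def FY_def star_def by blast
  next
    fix s t assume "(s, t) \<in> FM \<union> FX \<union> FY \<union> star x' {x} \<union> star y' {y}"
    then show "(s, t) \<in> E"
      using e T(4) by (auto simp: FM_def FX_def FY_def star_def dest: symD)
  qed
  have V: "V = (M \<union> Y) \<union> X" "V = (M \<union> X) \<union> Y" using XY by (auto simp: M_def)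
  have gMY: "glue M Y FM FY w {y}" if "w \<in> M" for w
    using that d sub sy fin XY by (auto simp: glue_def)
  have gMX: "glue M X FM FX w {x}" if "w \<in> M" for w
    using that d sub sy fin XY by (auto simp: glue_def)
  \<comment> \<open>What is left after splitting off \<open>X\<close> or \<open>Y\<close>. Viewing
    the same graph in both ways allows one branch to be moved at a time.\<close>
  define EMY where "EMY w = FM \<union> FY \<union> star w {y}" for w
  define EMX where "EMX w = FM \<union> FX \<union> star w {x}" for w
  have symMY: "sym (EMY w)" and symMX: "sym (EMX w)" for w
    using sy sym_star by (auto simp: EMY_def EMX_def intro!: sym_Un)
  have gX: "glue (M \<union> Y) X (EMY w) FX z {x}" if "w \<in> M" "z \<in> M" for w z
    using that d sub sy fin XY symMY by (auto simp: glue_def EMY_def star_def)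
  have gY: "glue (M \<union> X) Y (EMX w) FY z {y}" if "w \<in> M" "z \<in> M" for w z
    using that d sub sy fin XY symMX by (auto simp: glue_def EMX_def star_def)
  \<comment> \<open>\<open>G w z\<close> hangs \<open>X\<close> on \<open>w\<close> and
    \<open>Y\<close> on \<open>z\<close>: the given tree is \<open>G x' y'\<close>, the competitor
    is \<open>G y' x'\<close>, and \<open>G y' y'\<close> is the intermediate tree between two
    moves.\<close>
  define G where "G w z = FM \<union> FX \<union> FY \<union> star w {x} \<union> star z {y}" for w z
  have G_X: "G w z = EMY z \<union> FX \<union> star w {x}" and G_Y: "G w z = EMX w \<union> FY \<union> star z {y}" for w z
    by (auto simp: G_def EMX_def EMY_def)
  have EG: "E = G x' y'" using E_eq by (simp add: G_def)
  have "is_tree V (G x' y')" using optD(1)[OF opt] EG by simp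
  then have "is_tree V (G y' y')"
    unfolding G_X V(1) using glue.tree_move[OF gX[of y' x'], of y'] inM by simp
  then have T': "is_tree V (G y' x')"
    unfolding G_Y V(2) using glue.tree_move[OF gY[of y' y'], of x'] inM by simp
  have "deg (G y' x') z = deg (G x' y') z" for z
  proof -
    note eqs = deg_edge_glue[OF gY[OF inM(2,1)], of z, folded G_Y]
      deg_edge_glue[OF gY[OF inM(2,2)], of z, folded G_Y]
      deg_edge_glue[OF gX[OF inM(2,2)], of z, folded G_X]
      deg_edge_glue[OF gX[OF inM(2,1)], of z, folded G_X]
    show ?thesis using eqs by linarith
  qed
  then have "deg (G y' x') = deg (G x' y')" by (rule ext)
  then have "degs V (G y' x') = degs V E" by (simp add: degs_def EG)
  from optD(2)[OF opt T' this]
  have opt': "count_conn (G y' x') V {} \<le> count_conn (G x' y') V {}" by (simp add: EG)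
  define a b c p q where "a = count_conn FX X {x}" and "b = count_conn FY Y {y}"
    and "c = count_conn FM M {x', y'}" and "p = count_conn FM M {x'}" and "q = count_conn FM M {y'}"
  have yx: "{y', x'} = {x', y'}" by auto
  have P: "count_conn (EMY y') (M \<union> Y) {x'} = p + c * b"
    "count_conn (EMX x') (M \<union> X) {y'} = q + c * a"
    "count_conn (EMY x') (M \<union> Y) {y'} = q + c * b"
    using count_edge_glue(2)[OF gMY[of y'], of "{x'}"] count_edge_glue(2)[OF gMX[of x'], of "{y'}"]
      count_edge_glue(2)[OF gMY[of x'], of "{y'}"] inM
    by (simp_all add: a_def b_def c_def p_def q_def EMY_def EMX_def yx)
  have N: "count_conn (EMY y') (M \<union> Y) {} = count_conn FM M {} + count_conn FY Y {} + q * b"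
    "count_conn (EMY x') (M \<union> Y) {} = count_conn FM M {} + count_conn FY Y {} + p * b"
    using count_edge_glue(1)[OF gMY[of y']] count_edge_glue(1)[OF gMY[of x']] inM
    by (simp_all add: b_def p_def q_def EMY_def)
  have "count_conn (G x' y') V {} = count_conn FM M {} + count_conn FY Y {} + q * b
      + count_conn FX X {} + (p + c * b) * a"
    "count_conn (G y' x') V {} = count_conn FM M {} + count_conn FY Y {} + p * b
      + count_conn FX X {} + (q + c * b) * a"
    using count_edge_glue(1)[OF gX[of y' x']] count_edge_glue(1)[OF gX[of x' y']] inM N P
    by (simp_all add: a_def flip: G_X V)
  \<comment> \<open>Sets meeting both \<open>X\<close> and \<open>Y\<close> contribute
    \<open>a * b * c\<close> to either total and cancel.\<close>
  then have "b * p + a * q \<le> b * q + a * p"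
    using opt' by (simp add: algebra_simps)
  then have 1: "int b * int p + int a * int q \<le> int b * int q + int a * int p"
    by (simp only: of_nat_mult[symmetric] of_nat_add[symmetric] of_nat_le_iff)
  have 2: "0 < int a" "0 < int b" "0 \<le> int c" "int c < int p" "int c < int q"
    using count_conn_pos[OF fin(1) XY(4), of FX] count_conn_pos[OF fin(2) XY(5), of FY]
      count_conn_pair_less[OF fin(3) inM(1) ne[symmetric], of FM]
      count_conn_pair_less[OF fin(3) inM(2) ne, of FM]
    by (simp_all add: a_def b_def c_def p_def q_def yx)
  have f: "count_conn E V {x} = a * (1 + (p + c * b))" "count_conn E V {x'} = (p + c * b) * (1 + a)"
    "count_conn E V {y} = b * (1 + (q + c * a))" "count_conn E V {y'} = (q + c * a) * (1 + b)"
    using count_edge_glue(3,4)[OF gX[of y' x']] count_edge_glue(3,4)[OF gY[of x' y']] inM P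
    by (simp_all add: a_def b_def EG flip: G_X G_Y V)
  have "int (count_conn E V {x}) < int (count_conn E V {y}) \<longleftrightarrow>
      int (count_conn E V {x'}) < int (count_conn E V {y'})"
    unfolding f of_nat_mult of_nat_add of_nat_1 using 1 2 by (rule exchange_arith)
  then show ?thesis by simp
qed

section \<open>Breadth-first order of optimal trees\<close>

lemma (in rooted) root_desc: "x \<in> V \<Longrightarrow> x \<in> desc r"
proof (induction "dep x" arbitrary: x rule: less_induct)
  case less
  show ?case
  proof (cases "x = r")
    case False
    then have "p x \<in> desc r" using less par[of x] parV[of x] by auto
    moreover have "x \<in> children (p x)" using False less by (auto simp: children_def)
    ultimately show ?thesis by (rule desc_child[rotated])
  qed (simp add: desc_self)
qed

locale opt_rooted = rooted +
  assumes opt: "opt V E"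
    and root_max: "\<And>x. x \<in> V \<Longrightarrow> count_conn E V {x} \<le> count_conn E V {r}"
begin

abbreviation f :: "'a \<Rightarrow> nat" where "f x \<equiv> count_conn E V {x}"

lemma deg_mono: "x \<in> V \<Longrightarrow> y \<in> V \<Longrightarrow> f y \<le> f x \<Longrightarrow> deg E y \<le> deg E x"
  using opt_deg_less[OF opt, of x y] by linarith

text \<open>If \<open>f z < f w\<close> with \<open>w\<close> below \<open>z\<close>, the exchange property moves the violation outwards to the
  parent of \<open>z\<close> and a child of \<open>w\<close>, hence eventually to the root.\<close>

lemma desc_le: "z \<in> V \<Longrightarrow> w \<in> desc z \<Longrightarrow> f w \<le> f z"
proof (induction "dep z" arbitrary: z w rule: less_induct)
  case less
  have wV: "w \<in> V" using less desc_subset by blast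
  show ?case
  proof (cases "z = r \<or> w = z")
    case True
    then show ?thesis using root_max wV by auto
  next
    case False
    then have z: "z \<noteq> r" "w \<noteq> z" by auto
    show ?thesis
    proof (rule ccontr)
      assume "\<not> ?thesis"
      then have lt: "f z < f w" by simp
      \<comment> \<open>Since \<open>w\<close> lies below \<open>z\<close>, the vertex
        \<open>z\<close> has a child; the larger value at \<open>w\<close> forces at least as large
        a degree, so \<open>w\<close> has a child too.\<close>
      obtain c0 where "c0 \<in> children z" using desc_cases[OF less(3) z(2)] .
      then have "card (children z) > 0" using finite_children by (auto simp: card_gt_0_iff)
      moreover have "w \<noteq> r" using desc_parent[OF less(3) z(2)] by blast
      moreover have "deg E z \<le> deg E w" using deg_mono[OF wV less(2)] lt by simp
      ultimately have "card (children w) > 0"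
        using deg_nonroot[OF less(2) z(1)] deg_nonroot[OF wV] by simp
      then obtain c where c: "c \<in> children w" by fastforce
      then have cV: "c \<in> V" "c \<noteq> r" "p c = w" by (auto simp: children_def)
      have pz: "p z \<in> V" "z \<in> children (p z)" "p z \<notin> desc z"
        using parV parent_notin_desc less(2) z by (auto simp: children_def)
      have cz: "c \<in> desc z" by (rule desc_child[OF c less(3)])
      have wc: "w \<notin> desc c" using parent_notin_desc[OF cV(1,2)] cV by simp
      have zc: "z \<notin> desc c"
        using desc_dep[of z c] desc_dep[OF less(3)] children_dep[OF c] by auto
      \<comment> \<open>Exchange along the path from \<open>p z\<close> through \<open>z\<close> and
        \<open>w\<close> to \<open>c\<close>: the outer components are everything outside the branch
        at \<open>z\<close> and the branch at \<open>c\<close>.\<close>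
      have "f (p z) < f c \<longleftrightarrow> f z < f w"
      proof (rule opt_exchange[OF opt, where X = "V - desc z" and Y = "desc c"])
        show "(V - desc z) \<inter> desc c = {}" using desc_trans[OF _ cz] by blast
        show "(p z, z) \<in> E" "(c, w) \<in> E" using pz c by (auto simp: edge_iff)
        show "s = p z \<and> t = z" if "(s, t) \<in> E" "s \<in> V - desc z" "t \<notin> V - desc z" for s t
          using desc_enter[OF that(1), of z] that TD(3) by blast
        show "s = c \<and> t = w" if "(s, t) \<in> E" "s \<in> desc c" "t \<notin> desc c" for s t
          using desc_leave[OF that] cV by simp
      qed (use pz wc zc z less wV desc_subset[OF cV(1)] desc_self in auto)
      then have "f (p z) < f c" using lt by simp
      moreover have "c \<in> desc (p z)"
        using desc_trans[OF cz desc_child[OF pz(2) desc_self]] .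
      then have "f c \<le> f (p z)" using less(1)[of "p z" c] par[OF less(2) z(1)] pz by simp
      ultimately show False by simp
    qed
  qed
qed

text \<open>Incomparable vertices have disjoint branches, and the path between them begins and ends
  with the edges to their parents, so the exchange property applies.\<close>

lemma parents_exchange:
  assumes x: "x \<in> V" "x \<noteq> r" and y: "y \<in> V" "y \<noteq> r" and ne: "p x \<noteq> p y"
    and nd: "y \<notin> desc x" "x \<notin> desc y"
  shows "f x < f y \<longleftrightarrow> f (p x) < f (p y)"
proof (rule opt_exchange[OF opt, where X = "desc x" and Y = "desc y"])
  have ch: "x \<in> children (p x)" "y \<in> children (p y)" using x y by (auto simp: children_def)
  show "desc x \<inter> desc y = {}" using desc_linear nd by blast
  show "p x \<notin> desc y" "p y \<notin> desc x"
    using desc_child[OF ch(1)] desc_child[OF ch(2)] nd by blast+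
  show "p x \<notin> desc x" "p y \<notin> desc y" using parent_notin_desc x y by auto
  show "(x, p x) \<in> E" "(y, p y) \<in> E" using par x y by auto
  show "s = x \<and> t = p x" if "(s, t) \<in> E" "s \<in> desc x" "t \<notin> desc x" for s t
    using desc_leave[OF that] by simp
  show "s = y \<and> t = p y" if "(s, t) \<in> E" "s \<in> desc y" "t \<notin> desc y" for s t
    using desc_leave[OF that] by simp
qed (use x y ne parV desc_subset desc_self in auto)

text \<open>Climb from both vertices at the same pace. The gap in depth persists, so the parents
  stay distinct, until the upper vertex is the root or an ancestor of the lower one. There the
  choice of the root or \<open>desc_le\<close> decides, and \<open>parents_exchange\<close> carries
  the inequality back down.\<close>

lemma dep_less_le: "x \<in> V \<Longrightarrow> y \<in> V \<Longrightarrow> dep x < dep y \<Longrightarrow> f y \<le> f x"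
proof (induction "dep x" arbitrary: x y rule: less_induct)
  case less
  show ?case
  proof (cases "x = r \<or> y \<in> desc x")
    case True
    then show ?thesis using root_max desc_le less by auto
  next
    case False
    have y: "y \<noteq> r" using desc_dep[OF root_desc[OF less(2)]] less(4) by auto
    have d: "dep (p x) < dep x" "dep (p x) < dep (p y)"
      using par[of x] par[of y] less False y by auto
    then have "f (p y) \<le> f (p x)"
      using less(1)[of "p x" "p y"] parV less False y by auto
    moreover have "x \<notin> desc y" using desc_dep[of x y] less by auto
    ultimately show ?thesis
      using parents_exchange[of x y] less(2-4) False y d by (metis leD leI less_irrefl)
  qed
qed

lemma dep_eq_le:
  assumes "x \<in> V" "x \<noteq> r" "y \<in> V" "y \<noteq> r" "dep x = dep y" "p x \<noteq> p y" "f (p y) \<le> f (p x)"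
  shows "f y \<le> f x"
  using parents_exchange[of x y] desc_dep[of x y] desc_dep[of y x] assms
  by (metis leD leI less_irrefl)

section \<open>Breadth-first enumeration\<close>

definition first_child :: "'a list \<Rightarrow> nat \<Rightarrow> nat" where
  "first_child L j = Suc (\<Sum>l<j. card (children (L ! l)))"

definition consecutive :: "nat \<Rightarrow> 'a list \<Rightarrow> bool" where
  "consecutive j L \<longleftrightarrow>
     children (L ! j) = (!) L ` {first_child L j..<first_child L j + card (children (L ! j))}"

text \<open>The invariant after expanding the first \<open>i\<close> entries of the queue
  \<open>L\<close>, which keeps its expanded entries. \<open>first_child\<close> mirrors
  \<open>greedy_first_child\<close>, its extra 1 accounting for the root; the condition on the
  length says that the next block of children starts right at the end of \<open>L\<close>.\<close>

definition bfs :: "nat \<Rightarrow> 'a list \<Rightarrow> bool" where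
  "bfs i L \<longleftrightarrow> i \<le> length L \<and> L \<noteq> [] \<and> L ! 0 = r \<and> distinct L \<and>
     set L = insert r (\<Union>j<i. children (L ! j)) \<and>
     sorted_wrt (\<lambda>x y. f y \<le> f x \<and> dep x \<le> dep y) L \<and>
     length L = first_child L i \<and>
     (\<forall>j<i. consecutive j L)"

lemma sorted_children: "\<exists>xs. distinct xs \<and> set xs = children v \<and> sorted_wrt (\<lambda>x y. f y \<le> f x) xs"
proof -
  obtain xs where xs: "set xs = children v" "distinct xs"
    using finite_distinct_list[OF finite_children] by blast
  have "sorted_wrt (\<lambda>x y. f x \<le> f y) (sort_key f xs)"
    using sorted_sort_key[of f xs] by (simp add: sorted_map)
  then show ?thesis
    using xs by (intro exI[of _ "rev (sort_key f xs)"]) (simp add: sorted_wrt_rev)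
qed

text \<open>If every entry had been expanded, \<open>L\<close> would contain the root and be closed
  under children, hence contain all of \<open>V\<close>.\<close>

lemma bfs_incomplete:
  assumes L: "bfs i L" and i: "i < card V"
  shows "i < length L"
proof (rule ccontr)
  assume "\<not> ?thesis"
  moreover have "i \<le> length L" using L unfolding bfs_def by blast
  ultimately have len: "length L = i" by simp
  have setL: "set L = insert r (\<Union>j<i. children (L ! j))" using L unfolding bfs_def by blast
  have closed: "children v \<subseteq> set L" if "v \<in> set L" for v
  proof -
    obtain j where "j < i" "v = L ! j" using \<open>v \<in> set L\<close> len by (metis in_set_conv_nth)
    then show ?thesis unfolding setL by blast
  qed
  have "x \<in> set L" if "x \<in> V" for x
    using that
  proof (induction "dep x" arbitrary: x rule: less_induct)
    case less
    show ?case
    proof (cases "x = r")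
      case True then show ?thesis using setL by blast
    next
      case False
      then have "p x \<in> set L" using less par[of x] parV[of x] by auto
      moreover have "x \<in> children (p x)" using False less by (auto simp: children_def)
      ultimately show ?thesis using closed by blast
    qed
  qed
  then have "card V \<le> card (set L)" by (intro card_mono) auto
  then show False using i len card_length[of L] by linarith
qed

lemma bfs_step:
  assumes L: "bfs i L" and i: "i < card V"
  shows "\<exists>L'. bfs (Suc i) L'"
proof -
  have il: "i < length L" by (rule bfs_incomplete[OF L i])
  define v where "v = L ! i"
  obtain xs where xs: "distinct xs" "set xs = children v" "sorted_wrt (\<lambda>x y. f y \<le> f x) xs"
    using sorted_children by blast
  note Li = L[unfolded bfs_def]
  have setL: "set L = insert r (\<Union>j<i. children (L ! j))" using Li by blast
  have LV: "set L \<subseteq> V" using setL rV children_subset by auto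
  have vL: "v \<in> set L" using il by (simp add: v_def)
  have lenL: "length L = first_child L i" using Li by blast
  have dist: "distinct L" and sL: "sorted_wrt (\<lambda>x y. f y \<le> f x \<and> dep x \<le> dep y) L"
    using Li by blast+
  have nv: "L ! j \<noteq> v" if "j < i" for j
    using dist il that by (simp add: v_def nth_eq_iff_index_eq)
  have disj: "set L \<inter> children v = {}"
  proof -
    have "False" if c: "c \<in> children v" "c \<in> set L" for c
    proof -
      have "c \<noteq> r" "p c = v" using c by (auto simp: children_def)
      then obtain j where "j < i" "c \<in> children (L ! j)" using c(2) setL by auto
      then show False using nv[of j] \<open>p c = v\<close> by (auto simp: children_def)
    qed
    then show ?thesis by blast
  qed
  let ?L = "L @ xs"
  have nth: "?L ! j = L ! j" if "j \<le> i" for j using that il by (simp add: nth_append)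
  have len: "length xs = card (children v)" using xs distinct_card by metis
  have fc: "first_child ?L j = first_child L j" if "j \<le> Suc i" for j
    using that nth by (simp add: first_child_def)
  \<comment> \<open>The heart of the step: an old entry \<open>x\<close> is the root or a child of
    an earlier entry \<open>L ! j\<close>. At equal depths the order of the parents passes to the
    children; otherwise the smaller depth decides.\<close>
  have cross: "f y \<le> f x \<and> dep x \<le> dep y" if x: "x \<in> set L" and y: "y \<in> children v" for x y
  proof (cases "x = r")
    case True
    then show ?thesis
      using root_max desc_dep[OF root_desc] that children_subset by blast
  next
    case False
    then obtain j where j: "j < i" "x \<in> children (L ! j)" using x setL by auto
    have fv: "f v \<le> f (L ! j)" "dep (L ! j) \<le> dep v"
      using sorted_wrt_nth_less[OF sL j(1) il] by (simp_all add: v_def)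
    have d: "dep x = Suc (dep (L ! j))" "dep y = Suc (dep v)"
      using children_dep j that by auto
    have xy: "x \<in> V" "y \<in> V" "y \<noteq> r" "p y = v" "p x = L ! j"
      using that j by (auto simp: children_def)
    have "f y \<le> f x"
    proof (cases "dep x = dep y")
      case True
      then show ?thesis using dep_eq_le[of x y] xy False nv[OF j(1)] fv by simp
    next
      case neq: False
      then show ?thesis using dep_less_le[of x y] xy d fv by simp
    qed
    then show ?thesis using d fv by simp
  qed
  have "bfs (Suc i) ?L"
    unfolding bfs_def
  proof (intro conjI allI impI)
    show "Suc i \<le> length ?L" using il by simp
    have "L \<noteq> []" "L ! 0 = r" using Li by blast+
    then show "?L \<noteq> []" "?L ! 0 = r" by (simp_all add: nth_append)
    show "distinct ?L" using dist xs disj by simp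
    show "set ?L = insert r (\<Union>j<Suc i. children (?L ! j))"
    proof -
      have "(\<Union>j<Suc i. children (?L ! j)) = (\<Union>j<Suc i. children (L ! j))" using nth by auto
      then show ?thesis using xs(2) by (auto simp: setL lessThan_Suc v_def)
    qed
    have "sorted_wrt (\<lambda>x y. f y \<le> f x \<and> dep x \<le> dep y) xs"
      by (rule sorted_wrt_mono_rel[OF _ xs(3)]) (use xs(2) children_dep in auto)
    then show "sorted_wrt (\<lambda>x y. f y \<le> f x \<and> dep x \<le> dep y) ?L"
      using sL cross xs(2) by (simp add: sorted_wrt_append)
    show "length ?L = first_child ?L (Suc i)"
      using lenL len fc[of "Suc i"] by (simp add: first_child_def v_def)
    fix j assume j: "j < Suc i"
    show "consecutive j ?L"
    proof (cases "j = i")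
      case True
      have "first_child ?L i = length L" using fc[of i] lenL by simp
      then have "(!) ?L ` {first_child ?L j..<first_child ?L j + card (children (?L ! j))}
        = (!) ?L ` {length L..<length L + length xs}"
        using True nth[of i] len by (simp add: v_def)
      also have "\<dots> = set xs"
      proof (intro equalityI subsetI)
        fix x assume "x \<in> set xs"
        then obtain k where "k < length xs" "x = ?L ! (length L + k)"
          by (metis in_set_conv_nth nth_append_length_plus)
        then show "x \<in> (!) ?L ` {length L..<length L + length xs}"
          by (intro image_eqI[of _ _ "length L + k"]) simp_all
      qed (auto simp: nth_append)
      finally show ?thesis unfolding consecutive_def using True nth[of i] xs by (simp add: v_def)
    next
      case False
      then have ji: "j < i" using j by simp
      \<comment> \<open>A block of children recorded earlier ends within \<open>L\<close>, so
        appending does not touch it.\<close>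
      have "first_child L j + card (children (L ! j)) = first_child L (Suc j)"
        by (simp add: first_child_def)
      also have "\<dots> \<le> first_child L i"
        unfolding first_child_def using ji by (intro Suc_le_mono[THEN iffD2] sum_mono2) auto
      also have "\<dots> = length L" using lenL by simp
      finally have "(!) ?L ` {first_child L j..<first_child L j + card (children (L ! j))}
        = (!) L ` {first_child L j..<first_child L j + card (children (L ! j))}"
        by (intro image_cong) (auto simp: nth_append)
      also have "\<dots> = children (L ! j)"
        using Li ji unfolding consecutive_def by blast
      finally show ?thesis unfolding consecutive_def using ji nth[of j] fc[of j] by simp
    qed
  qed
  then show ?thesis by blast
qed

lemma bfs_exists: "i \<le> card V \<Longrightarrow> \<exists>L. bfs i L"
proof (induction i)
  case 0
  show ?case by (rule exI[of _ "[r]"]) (simp add: bfs_def first_child_def)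
next
  case (Suc i)
  then show ?case using bfs_step[of i] by auto
qed

lemma bfs_complete:
  assumes "bfs (card V) L"
  shows "set L = V" "length L = card V"
proof -
  have "set L = insert r (\<Union>j<card V. children (L ! j))" using assms unfolding bfs_def by blast
  then have "set L \<subseteq> V" using rV children_subset by auto
  then have "card (set L) \<le> card V" using TD(1) by (rule card_mono[rotated])
  moreover have "card (set L) = length L" "card V \<le> length L"
    using assms unfolding bfs_def by (blast intro: distinct_card)+
  ultimately show "length L = card V" by simp
  then show "set L = V"
    using \<open>set L \<subseteq> V\<close> TD(1) \<open>card (set L) = length L\<close> by (intro card_subset_eq) auto
qed

end

section \<open>Simple graphs as symmetric relations\<close>

lemma pair_graph_iff:
  "pair_graph G \<longleftrightarrow> finite (pverts G) \<and> parcs G \<subseteq> pverts G \<times> pverts G \<and> sym (parcs G) \<and> irrefl (parcs G)"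
proof
  assume "pair_graph G"
  then interpret pair_graph G .
  show "finite (pverts G) \<and> parcs G \<subseteq> pverts G \<times> pverts G \<and> sym (parcs G) \<and> irrefl (parcs G)"
    using pair_finite_verts in_arcsD1 in_arcsD2 pair_sym_arcs pair_no_loops
    by (fastforce simp: symmetric_def irrefl_def)
next
  assume *: "finite (pverts G) \<and> parcs G \<subseteq> pverts G \<times> pverts G \<and> sym (parcs G) \<and> irrefl (parcs G)"
  then have "finite (parcs G)" by (meson finite_SigmaI finite_subset)
  with * show "pair_graph G"
    by unfold_locales (auto simp: symmetric_def irrefl_def)
qed

lemma rtrancl_on_eq: "(u, v) \<in> rtrancl_on F r \<longleftrightarrow> u \<in> F \<and> (u, v) \<in> (r \<inter> F \<times> F)\<^sup>*"
proof
  assume "(u, v) \<in> rtrancl_on F r"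
  then show "u \<in> F \<and> (u, v) \<in> (r \<inter> F \<times> F)\<^sup>*"
    by induction (auto intro: converse_rtrancl_into_rtrancl)
next
  assume *: "u \<in> F \<and> (u, v) \<in> (r \<inter> F \<times> F)\<^sup>*"
  then have "(u, v) \<in> (r \<inter> F \<times> F)\<^sup>*" by blast
  then show "(u, v) \<in> rtrancl_on F r"
    by induction (use * in \<open>auto intro: rtrancl_on_into_rtrancl_on\<close>)
qed

lemma connected_iff:
  assumes "sym (parcs G)"
  shows "connected (with_proj G) \<longleftrightarrow> pverts G \<noteq> {} \<and> conn (parcs G) (pverts G)"
proof -
  have "(parcs G)\<^sup>s = parcs G" using assms by (auto simp: symcl_def dest: symD)
  then show ?thesis by (auto simp: connected_conv conn_def rtrancl_on_eq)
qed

section \<open>Walks, cycles and bridges\<close>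

lemma pcas_rtrancl: "pcas u q v \<Longrightarrow> set q \<subseteq> R \<Longrightarrow> (u, v) \<in> R\<^sup>*"
  by (induction q arbitrary: u) (auto intro: converse_rtrancl_into_rtrancl)

lemma pawalk_verts_ne: "pawalk_verts u q \<noteq> []"
  by (cases q) auto

lemma last_pawalk_verts: "pcas u q v \<Longrightarrow> last (pawalk_verts u q) = v"
  by (induction q arbitrary: u) (auto simp: pawalk_verts_ne)

lemma fst_in_butlast: "e \<in> set q \<Longrightarrow> fst e \<in> set (butlast (pawalk_verts u q))"
  by (induction q arbitrary: u) (auto simp: pawalk_verts_ne)

text \<open>A cycle of length at least 3 without one of its edges is a detour around that edge;
  conversely a simple detour closes up with its edge to such a cycle. The bound excludes the closed
  walk along an edge and back, of length 2.\<close>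

lemma acyc_iff:
  assumes "pair_graph G"
  shows "acyc (parcs G) \<longleftrightarrow> \<not> (\<exists>p. pre_digraph.cycle (with_proj G) p \<and> length p \<ge> 3)"
proof
  interpret pair_graph G by fact
  let ?E = "parcs G"
  show "\<not> (\<exists>p. pre_digraph.cycle (with_proj G) p \<and> length p \<ge> 3)" if acyc: "acyc ?E"
  proof
    assume "\<exists>p. pre_digraph.cycle (with_proj G) p \<and> length p \<ge> 3"
    then obtain p u where p: "awalk u p u" "distinct (tl (awalk_verts u p))" "length p \<ge> 3"
      by (auto simp: cycle_def)
    then obtain e q where eq: "p = e # q" by (cases p) auto
    define w where "w = snd e"
    have e: "e = (u, w)" using p eq by (cases e) (auto simp: awalk_def w_def)
    have q: "pcas w q u" "set q \<subseteq> ?E" "distinct (pawalk_verts w q)" "length q \<ge> 2" "(u, w) \<in> ?E"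
      using p eq e by (auto simp: awalk_def)
    have no_last: "fst d \<noteq> u" if "d \<in> set q" for d
    proof -
      have "pawalk_verts w q = butlast (pawalk_verts w q) @ [u]"
        using last_pawalk_verts[OF q(1)] pawalk_verts_ne[of w q] by (metis append_butlast_last_id)
      then have "u \<notin> set (butlast (pawalk_verts w q))" using q(3) by (metis distinct_butlast not_distinct_conv_prefix append.right_neutral)
      then show ?thesis using fst_in_butlast[OF that] by metis
    qed
    obtain d q' where dq: "q = d # q'" "q' \<noteq> []" using q(4) by (cases q; cases "tl q") auto
    \<comment> \<open>The walk does not return to \<open>w\<close>, so it could use the first edge
      backwards only at once; but then it would reach \<open>u\<close> with arcs still to
      come.\<close>
    have "(w, u) \<notin> set q"
    proof
      assume wu: "(w, u) \<in> set q"
      have d: "fst d = w" using q(1) dq by simp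
      have "w \<notin> set (pawalk_verts (snd d) q')" using q(3) d dq by simp
      then have "(w, u) \<notin> set q'" using fst_in_butlast[of "(w, u)" q' "snd d"] by (auto dest: in_set_butlastD)
      then have "d = (w, u)" using wu dq by auto
      moreover obtain d' where "d' \<in> set q'" "fst d' = snd d" using q(1) dq by (cases q') auto
      ultimately show False using no_last[of d'] dq by auto
    qed
    moreover have "(u, w) \<notin> set q" using no_last by force
    ultimately have "(w, u) \<in> (?E - {(w, u), (u, w)})\<^sup>*"
      using q by (intro pcas_rtrancl[OF q(1)]) auto
    moreover have "(w, u) \<in> ?E" using q(5) pair_sym_arcs by (auto simp: symmetric_def dest: symD)
    ultimately show False using acyc by (auto simp: acyc_def)
  qed
  show "acyc ?E" if no: "\<not> (\<exists>p. pre_digraph.cycle (with_proj G) p \<and> length p \<ge> 3)"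
    unfolding acyc_def
  proof (intro allI impI notI)
    fix u v assume uv: "(u, v) \<in> ?E" and path: "(u, v) \<in> (?E - {(u, v), (v, u)})\<^sup>*"
    define H where "H = \<lparr>pverts = pverts G, parcs = ?E - {(u, v), (v, u)}\<rparr>"
    interpret H: pair_wf_digraph H
      by unfold_locales (auto simp: H_def dest: in_arcsD1 in_arcsD2)
    have "(u, v) \<in> rtrancl_on (pverts H) (parcs H)"
    proof -
      have "parcs H \<inter> pverts H \<times> pverts H = ?E - {(u, v), (v, u)}"
        by (auto simp: H_def dest: in_arcsD1 in_arcsD2)
      then show ?thesis using path in_arcsD1[OF uv] by (simp add: rtrancl_on_eq) (simp add: H_def)
    qed
    then have "reachable (with_proj H) u v" by (simp add: reachable_def)
    then obtain q0 where "H.awalk u q0 v" using H.reachable_awalk by blast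
    then obtain q where q: "H.apath u q v" using H.apath_awalk_to_apath by blast
    then have q': "pcas u q v" "set q \<subseteq> ?E - {(u, v), (v, u)}" "distinct (pawalk_verts u q)"
      by (auto simp: H.apath_def H.awalk_def) (auto simp: H_def)
    have vu: "(v, u) \<in> ?E" using uv pair_sym_arcs by (auto simp: symmetric_def dest: symD)
    have "u \<noteq> v" using uv pair_no_loops by force
    \<comment> \<open>A shorter detour would be empty or the edge itself; so the closed walk has at
      least three arcs.\<close>
    have "length q \<ge> 2"
    proof (rule ccontr)
      assume "\<not> ?thesis"
      then consider "q = []" | e where "q = [e]" by (cases q; cases "tl q") auto
      then show False
        by cases (use q' \<open>u \<noteq> v\<close> in auto)
    qed
    moreover have "awalk v ((v, u) # q) v" using q' vu in_arcsD1[OF vu] by (auto simp: awalk_def)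
    then have "cycle ((v, u) # q)" using q'(3) by (auto simp: cycle_def)
    ultimately show False using no by (metis Suc_le_mono length_Cons numeral_2_eq_2 numeral_3_eq_3)
  qed
qed

lemma utree_iff: "utree T \<longleftrightarrow> is_tree (pverts T) (parcs T)"
proof
  assume u: "utree T"
  then have g: "pair_graph T" by (simp add: utree_def)
  note g' = g[unfolded pair_graph_iff]
  show "is_tree (pverts T) (parcs T)"
    using u g' acyc_iff[OF g] connected_iff[of T] by (simp add: utree_def is_tree_def)
next
  assume t: "is_tree (pverts T) (parcs T)"
  have g: "pair_graph T"
    unfolding pair_graph_iff irrefl_def using is_treeD[OF t] acyc_irrefl[of "parcs T"] by blast
  show "utree T"
    using t g acyc_iff[OF g] connected_iff[of T] by (simp add: utree_def is_tree_def)
qed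

text \<open>A connected subgraph of a forest contains every edge between its vertices, because edges are
  bridges.\<close>

lemma num_subtrees_eq:
  assumes "utree T"
  shows "num_subtrees T = count_conn (parcs T) (pverts T) {}"
proof -
  let ?E = "parcs T" and ?V = "pverts T"
  have t: "is_tree ?V ?E" using assms by (simp add: utree_iff)
  note TD = is_treeD[OF t]
  have gT: "pair_graph T" using assms by (simp add: utree_def)
  define F where "F W = \<lparr>pverts = W, parcs = ?E \<inter> W \<times> W\<rparr>" for W
  have sub: "S \<in> subtrees T \<longleftrightarrow> pair_graph S \<and> pverts S \<subseteq> ?V \<and> parcs S \<subseteq> ?E
      \<and> pverts S \<noteq> {} \<and> conn (parcs S) (pverts S)" for S
  proof -
    have "subgraph (with_proj S) (with_proj T) \<longleftrightarrow> pverts S \<subseteq> ?V \<and> parcs S \<subseteq> ?E" if S: "pair_graph S"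
    proof -
      interpret S: pair_graph S by fact
      interpret T: pair_graph T by fact
      show ?thesis
        using S.wf_digraph_axioms T.wf_digraph_axioms by (auto simp: subgraph_def compatible_def)
    qed
    then show ?thesis
      using connected_iff[of S] by (auto simp: subtrees_def pair_graph_iff)
  qed
  have "subtrees T = F ` csets ?E ?V {}"
  proof (intro equalityI subsetI)
    fix S assume "S \<in> subtrees T"
    then have S: "pair_graph S" "pverts S \<subseteq> ?V" "parcs S \<subseteq> ?E" "pverts S \<noteq> {}"
      "conn (parcs S) (pverts S)"
      by (auto simp: sub)
    have arcs: "parcs S \<subseteq> pverts S \<times> pverts S" using S(1) by (simp add: pair_graph_iff)
    have symS: "sym (parcs S)" using S(1) by (simp add: pair_graph_iff)
    have "?E \<inter> pverts S \<times> pverts S \<subseteq> parcs S"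
    proof (intro subrelI, rule ccontr)
      fix u v assume uv: "(u, v) \<in> ?E \<inter> pverts S \<times> pverts S" and n: "(u, v) \<notin> parcs S"
      have "(v, u) \<notin> parcs S" using n symS by (meson symD)
      have "parcs S \<inter> pverts S \<times> pverts S = parcs S" using arcs by auto
      then have "(u, v) \<in> (parcs S)\<^sup>*" using S(5) uv by (auto simp: conn_def)
      then have "(u, v) \<in> (?E - {(u, v), (v, u)})\<^sup>*"
        by (rule rtrancl_mono[THEN subsetD, rotated]) (use S(3) n \<open>(v, u) \<notin> parcs S\<close> in auto)
      then show False using uv TD(5) by (auto simp: acyc_def)
    qed
    then have eq: "parcs S = ?E \<inter> pverts S \<times> pverts S" using arcs S(3) by blast
    then have "S = F (pverts S)" by (simp add: F_def)
    moreover have "conn ?E (pverts S)"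
      using S(5) eq unfolding conn_def by (metis inf.right_idem)
    then have "pverts S \<in> csets ?E ?V {}" using S by (simp add: csets_def)
    ultimately show "S \<in> F ` csets ?E ?V {}" by blast
  next
    fix S assume "S \<in> F ` csets ?E ?V {}"
    then obtain W where W: "S = F W" "W \<noteq> {}" "W \<subseteq> ?V" "conn ?E W" by (auto simp: csets_def)
    have "pair_graph S"
      using W finite_subset[OF W(3) TD(1)] sym_restrict[OF TD(4)] acyc_irrefl[OF TD(5)]
      by (auto simp: pair_graph_iff F_def irrefl_def)
    moreover have "conn (?E \<inter> W \<times> W) W" using W(4) by (auto simp: conn_def Int_assoc)
    ultimately show "S \<in> subtrees T" using W by (auto simp: sub F_def)
  qed
  moreover have "inj_on F (csets ?E ?V {})"
    by (rule inj_onI) (simp add: F_def)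
  ultimately show ?thesis
    by (simp add: num_subtrees_def count_conn_def card_image)
qed

lemma out_degree_eq: "out_degree (with_proj G) v = deg (parcs G) v"
proof -
  have "out_arcs (with_proj G) v = Pair v ` (parcs G `` {v})"
    by (auto simp: out_arcs_def)
  then show ?thesis by (simp add: out_degree_def deg_def card_image inj_on_def)
qed

lemma degree_sequence_eq:
  assumes "finite (pverts T)"
  shows "degree_sequence T =
    rev (sorted_list_of_multiset (filter_mset (\<lambda>d. d \<noteq> 1) (degs (pverts T) (parcs T))))"
proof -
  have "out_degree (with_proj T) = deg (parcs T)" by (rule ext) (rule out_degree_eq)
  then show ?thesis
    using assms by (simp add: degree_sequence_def degs_def filter_mset_image_mset filter_mset_mset_set
        del: One_nat_def)
qed

section \<open>Isomorphisms\<close>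

lemma conn_image:
  assumes "conn E S"
  shows "conn (map_prod h h ` E) (h ` S)"
  unfolding conn_def
proof (intro ballI)
  fix u v assume "u \<in> h ` S" "v \<in> h ` S"
  then obtain u' v' where uv: "u = h u'" "v = h v'" "u' \<in> S" "v' \<in> S" by blast
  then have "(u', v') \<in> (E \<inter> S \<times> S)\<^sup>*" using assms by (auto simp: conn_def)
  then show "(u, v) \<in> (map_prod h h ` E \<inter> h ` S \<times> h ` S)\<^sup>*"
    unfolding uv by (rule rtrancl_map) (auto intro!: r_into_rtrancl)
qed

text \<open>The optimal tree lives on the vertices of the given tree, the greedy tree on natural
  numbers; \<open>h\<close> carries counts, degrees and the tree property across.\<close>

locale iso =
  fixes V :: "'a set" and E :: "('a \<times> 'a) set" and h :: "'a \<Rightarrow> 'b"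
  assumes E: "E \<subseteq> V \<times> V" and inj: "inj_on h V"
begin

abbreviation "hE \<equiv> map_prod h h ` E"
abbreviation "g \<equiv> inv_into V h"

lemma gh: "x \<in> V \<Longrightarrow> g (h x) = x"
  using inj by simp

lemma ghE: "map_prod g g ` hE = E"
proof -
  have "map_prod g g (map_prod h h e) = e" if "e \<in> E" for e
    using that E gh by (cases e) auto
  then show ?thesis by (force simp: image_image)
qed

lemma count_iso: "count_conn hE (h ` V) {} = count_conn E V {}"
proof -
  have "csets hE (h ` V) {} = (`) h ` csets E V {}"
  proof (intro equalityI subsetI)
    fix S assume "S \<in> csets hE (h ` V) {}"
    then have S: "S \<noteq> {}" "S \<subseteq> h ` V" "conn hE S" by (auto simp: csets_def)
    have "g ` S \<subseteq> V" using S(2) gh by auto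
    moreover have "h ` g ` S = S" using S(2) by (force simp: image_image f_inv_into_f)
    moreover have "conn E (g ` S)" using conn_image[OF S(3), of g] ghE by simp
    ultimately show "S \<in> (`) h ` csets E V {}"
      using S(1) by (intro image_eqI[of _ _ "g ` S"]) (auto simp: csets_def)
  next
    fix S assume "S \<in> (`) h ` csets E V {}"
    then show "S \<in> csets hE (h ` V) {}" by (auto simp: csets_def intro: conn_image)
  qed
  moreover have "inj_on ((`) h) (csets E V {})"
    by (rule inj_on_subset[OF inj_on_image_Pow[OF inj]]) (auto simp: csets_def)
  ultimately show ?thesis by (simp add: count_conn_def card_image)
qed

lemma deg_iso: "v \<in> V \<Longrightarrow> deg hE (h v) = deg E v"
proof -
  assume v: "v \<in> V"
  have "hE `` {h v} = h ` (E `` {v})"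
  proof
    show "hE `` {h v} \<subseteq> h ` (E `` {v})"
      using v E inj by (auto dest!: inj_onD[OF inj])
  qed auto
  moreover have "inj_on h (E `` {v})" by (rule inj_on_subset[OF inj]) (use E in auto)
  ultimately show ?thesis by (simp add: deg_def card_image)
qed

lemma degs_iso: "degs (h ` V) hE = degs V E"
proof -
  have "degs (h ` V) hE = image_mset (deg hE \<circ> h) (mset_set V)"
    using inj by (simp add: degs_def image_mset_mset_set[symmetric] multiset.map_comp)
  also have "\<dots> = image_mset (deg E) (mset_set V)"
    by (cases "finite V") (auto intro!: image_mset_cong simp: deg_iso)
  finally show ?thesis by (simp add: degs_def)
qed

lemma tree_iso:
  assumes T: "is_tree V E"
  shows "is_tree (h ` V) hE"
proof -
  note TD = is_treeD[OF T]
  have "acyc hE"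
    unfolding acyc_def
  proof (intro allI impI notI)
    fix u v assume "(u, v) \<in> hE" and path: "(u, v) \<in> (hE - {(u, v), (v, u)})\<^sup>*"
    then obtain x y where xy: "u = h x" "v = h y" "(x, y) \<in> E" by auto
    then have V: "x \<in> V" "y \<in> V" using E by auto
    have "(g u, g v) \<in> (E - {(x, y), (y, x)})\<^sup>*"
      using path
    proof (rule rtrancl_map)
      fix a b assume "(a, b) \<in> hE - {(u, v), (v, u)}"
      then obtain c d where "a = h c" "b = h d" "(c, d) \<in> E - {(x, y), (y, x)}" using xy by auto
      moreover from this have "c \<in> V" "d \<in> V" using E by auto
      ultimately show "(g a, g b) \<in> (E - {(x, y), (y, x)})\<^sup>*" using gh by auto
    qed
    then show False using TD(5) xy V gh by (auto simp: acyc_def)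
  qed
  moreover have "conn hE (h ` V)" using T conn_image by (auto simp: is_tree_def)
  moreover have "sym hE" using TD(4) by (fastforce simp: sym_def)
  ultimately show ?thesis using TD by (auto simp: is_tree_def)
qed

end

section \<open>The greedy tree\<close>

lemma degs_from_sequence:
  assumes ds: "filter_mset (\<lambda>d. d \<noteq> 1) (degs V E) = mset ds"
  shows "degs V E = mset ds + replicate_mset (card V - length ds) 1"
    and "length ds \<le> card V"
proof -
  have "filter_mset (\<lambda>d. \<not> d \<noteq> 1) (degs V E) = replicate_mset (count (degs V E) 1) 1"
    by (simp add: filter_eq_replicate_mset eq_commute)
  then have eq: "degs V E = mset ds + replicate_mset (count (degs V E) 1) 1"
    using multiset_partition[of "degs V E" "\<lambda>d. d \<noteq> 1"] ds by simp
  have "card V = size (degs V E)" by (simp add: degs_def)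
  also have "\<dots> = length ds + count (degs V E) 1"
    by (subst eq) simp
  finally have n: "card V = length ds + count (degs V E) 1" .
  then show "length ds \<le> card V" "degs V E = mset ds + replicate_mset (card V - length ds) 1"
    using eq by simp_all
qed

context opt_rooted
begin

text \<open>The isomorphism sends a vertex to its position in the breadth-first list. Both trees
  hand out consecutive blocks of children, and the block sizes agree because the degrees along the
  list do.\<close>

lemma greedy_iso:
  assumes ds: "sorted_wrt (\<ge>) ds" "\<forall>d\<in>set ds. d \<ge> 2"
    and degs: "degs V E = mset ds + replicate_mset (card V - length ds) 1"
    and len: "length ds \<le> card V"
  obtains h where "inj_on h V" "pverts (greedy_tree ds) = h ` V" "parcs (greedy_tree ds) = map_prod h h ` E"
proof -
  let ?n = "card V"
  obtain L where L: "bfs ?n L" using bfs_exists by blast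
  have LV: "set L = V" and Ln: "length L = ?n" using bfs_complete[OF L] by auto
  have L0: "L ! 0 = r" and dist: "distinct L" and LNil: "L \<noteq> []"
    and sL: "sorted_wrt (\<lambda>x y. f y \<le> f x \<and> dep x \<le> dep y) L"
    and lenL: "length L = first_child L ?n"
    and cons: "\<And>j. j < ?n \<Longrightarrow> consecutive j L"
    using L unfolding bfs_def by blast+
  have npos: "0 < ?n" using Ln LNil by (metis length_greater_0_conv)
  have inV: "L ! i \<in> V" if "i < ?n" for i using that LV Ln nth_mem by metis
  let ?ds = "ds @ replicate (?n - length ds) 1"
  \<comment> \<open>The list is non-increasing in f, hence in degree by \<open>deg_mono\<close>; two
    non-increasing lists with the same multiset of entries coincide.\<close>
  have degL: "map (deg E) L = ?ds"
  proof -
    have "mset (map (deg E) L) = degs V E"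
      using dist LV by (metis degs_def mset_map mset_set_set)
    then have m: "mset (rev (map (deg E) L)) = mset (rev ?ds)" using degs by simp
    have "sorted_wrt (\<lambda>x y. deg E y \<le> deg E x) L"
      by (rule sorted_wrt_mono_rel[OF _ sL]) (use LV deg_mono in auto)
    then have s1: "sorted (rev (map (deg E) L))" by (simp add: sorted_wrt_rev sorted_wrt_map)
    have "sorted_wrt (\<ge>) ?ds"
    proof -
      have "sorted_wrt (\<ge>) (replicate k (1 :: nat))" for k by (induction k) auto
      moreover have "1 \<le> d" if "d \<in> set ds" for d using ds(2) that by fastforce
      ultimately show ?thesis using ds(1) by (auto simp: sorted_wrt_append)
    qed
    then have s2: "sorted (rev ?ds)" by (simp only: sorted_wrt_rev)
    have "rev (map (deg E) L) = rev ?ds"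
      using m s1 s2 by (metis properties_for_sort)
    then show ?thesis by (simp only: rev_is_rev_conv)
  qed
  have deg_nth: "deg E (L ! i) = greedy_degree ds i" if "i < ?n" for i
  proof -
    have "deg E (L ! i) = ?ds ! i" using degL that Ln by (metis nth_map)
    then show ?thesis using that len by (auto simp: greedy_degree_def nth_append)
  qed
  have nc: "card (children (L ! i)) = greedy_num_children ds i" if "i < ?n" for i
  proof (cases "i = 0")
    case True
    then show ?thesis using deg_nth[OF that] deg_root L0 by (simp add: greedy_num_children_def)
  next
    case False
    then have "L ! i \<noteq> r" using dist that Ln npos L0 by (metis nth_eq_iff_index_eq)
    then show ?thesis
      using deg_nth[OF that] deg_nonroot[OF inV[OF that]] False by (simp add: greedy_num_children_def)
  qed
  \<comment> \<open>Beyond \<open>ds\<close> the degree defaults to 1, which for a non-root index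
    means no children; \<open>npos\<close> rules out index 0.\<close>
  have nc0: "greedy_num_children ds i = 0" if "?n \<le> i" for i
    using that len npos by (auto simp: greedy_num_children_def greedy_degree_def)
  have fc: "first_child L j = greedy_first_child ds j" if "j \<le> ?n" for j
    using that nc by (simp add: first_child_def greedy_first_child_def)
  have bound: "greedy_first_child ds i + greedy_num_children ds i \<le> ?n" if "i < ?n" for i
  proof -
    have "greedy_first_child ds i + greedy_num_children ds i = greedy_first_child ds (Suc i)"
      by (simp add: greedy_first_child_def)
    also have "\<dots> \<le> greedy_first_child ds ?n"
      unfolding greedy_first_child_def using that by (intro add_left_mono sum_mono2) auto
    also have "\<dots> = ?n" using fc[of ?n] lenL Ln by simp
    finally show ?thesis .
  qed
  define A where "A = {(i, j). j \<in> greedy_children ds i}"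
  have A: "(i, j) \<in> A \<longleftrightarrow> i < ?n \<and> j < ?n \<and> L ! j \<in> children (L ! i)" for i j
  proof (cases "i < ?n")
    case True
    have img: "children (L ! i) = (!) L ` greedy_children ds i"
      using cons[OF True] fc[of i] nc[OF True] True
      by (simp add: consecutive_def greedy_children_def)
    have sub: "greedy_children ds i \<subseteq> {..<?n}" using bound[OF True] by (auto simp: greedy_children_def)
    have "j \<in> greedy_children ds i \<longleftrightarrow> j < ?n \<and> L ! j \<in> (!) L ` greedy_children ds i"
    proof
      assume "j < ?n \<and> L ! j \<in> (!) L ` greedy_children ds i"
      then obtain k where "k \<in> greedy_children ds i" "j < ?n" "L ! j = L ! k" by auto
      moreover from this have "k < ?n" using sub by auto
      ultimately show "j \<in> greedy_children ds i" using dist Ln by (simp add: nth_eq_iff_index_eq)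
    qed (use sub in auto)
    then show ?thesis using True img by (simp add: A_def)
  next
    case False
    then show ?thesis using nc0[of i] by (simp add: A_def greedy_children_def)
  qed
  define h where "h = inv_into {..<?n} ((!) L)"
  have injL: "inj_on ((!) L) {..<?n}" using dist Ln by (auto simp: inj_on_def nth_eq_iff_index_eq)
  have imL: "(!) L ` {..<?n} = V"
    using nth_image[of "length L" L] LV Ln by (simp add: atLeast0LessThan)
  have hL: "h (L ! i) = i" if "i < ?n" for i using injL that by (simp add: h_def)
  have Lh: "L ! h x = x" "h x < ?n" if "x \<in> V" for x
    using that imL f_inv_into_f[of x "(!) L" "{..<?n}"] inv_into_into[of x "(!) L" "{..<?n}"]
    by (auto simp: h_def)
  have "inj_on h V" by (rule inj_on_inverseI[of _ "(!) L"]) (rule Lh)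
  moreover have hV: "h ` V = {..<?n}" using Lh(2) hL inV by (force simp: image_iff)
  moreover have "insert 0 (Range A) = {..<?n}"
  proof
    show "insert 0 (Range A) \<subseteq> {..<?n}" using A npos by auto
    show "{..<?n} \<subseteq> insert 0 (Range A)"
    proof
      fix j assume j: "j \<in> {..<?n}"
      show "j \<in> insert 0 (Range A)"
      proof (cases "j = 0")
        case False
        then have jr: "L ! j \<noteq> r" using dist j Ln npos L0 by (metis lessThan_iff nth_eq_iff_index_eq)
        have V: "L ! j \<in> V" using inV j by simp
        then have "L ! j \<in> children (p (L ! j))" using jr by (simp add: children_def)
        moreover have "p (L ! j) \<in> V" using parV V jr by simp
        ultimately have "(h (p (L ! j)), j) \<in> A" using A j Lh by simp
        then show ?thesis by blast
      qed simp
    qed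
  qed
  then have "pverts (greedy_tree ds) = {..<?n}"
    by (simp add: greedy_tree_def A_def Let_def)
  moreover have "parcs (greedy_tree ds) = map_prod h h ` E"
  proof -
    have "parcs (greedy_tree ds) = A \<union> A\<inverse>" by (simp add: greedy_tree_def A_def Let_def)
    also have "\<dots> = map_prod h h ` E"
    proof (intro equalityI subrelI)
      fix i j assume "(i, j) \<in> A \<union> A\<inverse>"
      then have "i < ?n" "j < ?n" "(L ! i, L ! j) \<in> E" using A by (auto simp: edge_iff)
      then have "(i, j) = map_prod h h (L ! i, L ! j)" using hL by simp
      then show "(i, j) \<in> map_prod h h ` E" using \<open>(L ! i, L ! j) \<in> E\<close> by blast
    next
      fix i j assume "(i, j) \<in> map_prod h h ` E"
      then obtain x y where xy: "i = h x" "j = h y" "(x, y) \<in> E" by auto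
      moreover from this have "x \<in> V" "y \<in> V" using TD(3) by auto
      ultimately show "(i, j) \<in> A \<union> A\<inverse>" using A Lh edge_iff by auto
    qed
    finally show ?thesis .
  qed
  ultimately show thesis using that by metis
qed

end

section \<open>Existence of optimal trees and conclusion\<close>

lemma opt_exists:
  assumes T: "is_tree V E"
  obtains E' where "opt V E'" "degs V E' = degs V E" "count_conn E V {} \<le> count_conn E' V {}"
proof -
  let ?S = "{E'. is_tree V E' \<and> degs V E' = degs V E}"
  have "?S \<subseteq> Pow (V \<times> V)" by (auto dest: is_treeD(3))
  then have fin: "finite ?S" using is_treeD(1)[OF T] by (meson finite_Pow_iff finite_SigmaI finite_subset)
  have "E \<in> ?S" using T by simp
  then have ne: "?S \<noteq> {}" by blast
  obtain E' where E': "E' \<in> ?S" and max: "(MAX F\<in>?S. count_conn F V {}) = count_conn E' V {}"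
    by (rule obtains_MAX[OF fin ne, of "\<lambda>F. count_conn F V {}"])
  have best: "count_conn F V {} \<le> count_conn E' V {}" if "F \<in> ?S" for F
    unfolding max[symmetric] by (rule Max_ge[OF finite_imageI[OF fin] imageI[OF that]])
  then have "opt V E'" using E' by (auto simp: opt_def)
  then show thesis using that E' best[OF \<open>E \<in> ?S\<close>] by blast
qed

text \<open>An optimal competitor of \<open>T\<close>, rooted where f is largest, is isomorphic to
  the greedy tree. This also yields that the greedy tree is a tree with the right degree sequence,
  without a computation from its definition.\<close>

lemma greedy_best:
  fixes T :: "'a pair_pre_digraph"
  assumes ds: "sorted_wrt (\<ge>) ds" "\<forall>d\<in>set ds. d \<ge> 2"
    and T: "utree T" "degree_sequence T = ds"
  shows "utree (greedy_tree ds)" "degree_sequence (greedy_tree ds) = ds"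
    "num_subtrees T \<le> num_subtrees (greedy_tree ds)"
proof -
  let ?V = "pverts T"
  have t: "is_tree ?V (parcs T)" using T(1) by (simp add: utree_iff)
  obtain E where E: "opt ?V E" "degs ?V E = degs ?V (parcs T)"
    and better: "count_conn (parcs T) ?V {} \<le> count_conn E ?V {}"
    using opt_exists[OF t] .
  have tE: "is_tree ?V E" using E(1) by (rule optD)
  note TD = is_treeD[OF tE]
  have seq: "rev (sorted_list_of_multiset (filter_mset (\<lambda>d. d \<noteq> 1) (degs ?V E))) = ds"
    using T(2) degree_sequence_eq[OF TD(1)] E(2) by simp
  then have "filter_mset (\<lambda>d. d \<noteq> 1) (degs ?V E) = mset ds"
    by (metis mset_rev mset_sorted_list_of_multiset)
  note D = degs_from_sequence[OF this]
  obtain r where r: "r \<in> ?V" and max: "(MAX x\<in>?V. count_conn E ?V {x}) = count_conn E ?V {r}"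
    by (rule obtains_MAX[OF TD(1,2), of "\<lambda>x. count_conn E ?V {x}"])
  have best: "count_conn E ?V {x} \<le> count_conn E ?V {r}" if "x \<in> ?V" for x
    unfolding max[symmetric] by (rule Max_ge[OF finite_imageI[OF TD(1)] imageI[OF that]])
  obtain p dep where "rooted ?V E r p dep" using rooted_exists[OF tE r] by blast
  then have "opt_rooted ?V E r p dep"
    using E(1) best by (simp add: opt_rooted_def opt_rooted_axioms_def)
  then obtain h where h: "inj_on h ?V" "pverts (greedy_tree ds) = h ` ?V"
      "parcs (greedy_tree ds) = map_prod h h ` E"
    using opt_rooted.greedy_iso[OF _ ds D(1,2)] by blast
  interpret iso ?V E h using TD(3) h(1) by unfold_locales
  show G: "utree (greedy_tree ds)" unfolding utree_iff h using tree_iso[OF tE] .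
  show "degree_sequence (greedy_tree ds) = ds"
    using degree_sequence_eq[of "greedy_tree ds"] seq TD(1) by (simp add: h degs_iso)
  show "num_subtrees T \<le> num_subtrees (greedy_tree ds)"
    using better by (simp add: num_subtrees_eq[OF T(1)] num_subtrees_eq[OF G] h count_iso)
qed

theorem theorem3p2:
  fixes ds :: "nat list"
  assumes "sorted_wrt (\<ge>) ds"
    and "\<forall>d \<in> set ds. d \<ge> 2"
    and "\<exists>T :: nat pair_pre_digraph. utree T \<and> degree_sequence T = ds"
  shows "utree (greedy_tree ds) \<and> degree_sequence (greedy_tree ds) = ds \<and>
    (\<forall>T :: 'a pair_pre_digraph. utree T \<and> degree_sequence T = ds \<longrightarrow>
       num_subtrees T \<le> num_subtrees (greedy_tree ds))"
  \<comment> \<open>The witness over \<open>nat\<close> gives the tree property and the degree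
    sequence; an arbitrary \<open>T\<close> over \<open>'a\<close> gives the inequality.\<close>
  using greedy_best[OF assms(1,2)] assms(3) by blast

end
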